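(* Let $\Gamma$ be a cocompact torsion free Fuchsian group such that $S=\Gamma\backslash\mathbb{D}$ is a surface of genus $g\ge 2$. Let $\mathcal{F}$ be an $(8g-4)$-sided fundamental polygon for $\Gamma$ as described in the context, with associated boundary points $P_k,Q_k$ and generators $T_k$ ($1\le k\le 8g-4$). For any $\bar A=\{A_1,\dots,A_{8g-4}\}$ with $A_k\in[P_k,Q_k]$ for all $k$, the map $f_{\bar A}:\mathbb{S}\to\mathbb{S}$ defined by $f_{\bar A}(x)=T_k(x)$ if $x\in[A_k,A_{k+1})$ has topological entropy $$h_{\mathrm{top}}(f_{\bar A})=\log\left(4g-3+\sqrt{(4g-3)^2-1}\right).$$
   Context: $\mathbb{D}=\{z\in\mathbb{C}:|z|<1\}$ is the unit disc with hyperbolic metric $2|dz|/(1-|z|^2)$, and $\Gamma$ acts on it freely by M\"obius transformations. The boundary circle $\partial\mathbb{D}$ is identified with $\mathbb{S}=\mathbb{R}/2\pi\mathbb{Z}$ via $x\mapsto e^{ix}$; the same symbol denotes a M\"obius transformation on $\overline{\mathbb{D}}$ and its action on $\mathbb{S}$. Intervals $[a,b]$, $[a,b)$ in $\mathbb{S}$ are counter-clockwise arcs from $a$ to $b$. Indices $k$ of sides, vertices, points $P_k,Q_k,A_k$ and generators are taken mod $8g-4$. Polygon and generators. $\mathcal{F}$ is a (not necessarily regular) $(8g-4)$-sided fundamental polygon for $\Gamma$ whose sides are geodesic segments labelled $1,\dots,8g-4$ counter-clockwise; $V_k$ is the vertex where sides $k-1$ and $k$ meet. The side pairing rule is $$\sigma(k)=\begin{cases}4g-k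 \bmod (8g-4) & k \text{ odd}\\ 2-k \bmod (8g-4) & k\text{ even,}\end{cases}$$ and $\rho(k)=\sigma(k)+1$. Side $k$ and side $\sigma(k)$ have equal length, and the internal angles at $V_k$ and $V_{\sigma(k)+1}$ sum to $\pi$. The sides satisfy the extension condition: the geodesic extensions of the sides never intersect the interior of the sets $\gamma\mathcal{F}$, $\gamma\in\Gamma$. The generator $T_k\in\Gamma$ maps side $k$ onto side $\sigma(k)$, with $T_k(V_k)=V_{\rho(k)}$, $T_{\sigma(k)}T_k=\mathrm{Id}$, and $T_{\rho^3(k)}T_{\rho^2(k)}T_{\rho(k)}T_k=\mathrm{Id}$. (The space of all such marked polygons, up to isometry of $\mathbb{D}$, is the Teichm\"uller space of $S$.) The oriented infinite geodesic extending side $k$ goes from $P_k\in\partial\mathbb{D}$ to $Q_{k+1}\in\partial\mathbb{D}$. The counter-clockwise order of these endpoints on $\partial\mathbb{D}$ is $P_1,Q_1,P_2,Q_2,\dots,P_{8g-4},Q_{8g-4}$. Topological entropy of the piecewise continuous, piecewise monotone circle map is understood via Bowen's definition: $h_{\mathrm{top}}(f)=\lim_{\varepsilon\to0}\limsup_{n\to\infty}\frac1n\log s(n,\varepsilon)$, where $s(n,\varepsilon)$ is the maximal cardinality of an $(n,\varepsilon)$-separated set (a set in which any two distinct points $x,y$ satisfy $d(f^i x,f^i y)>\varepsilon$ for some $0\le i<n$). *)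

theory Defs
  imports
    "HOL-Complex_Analysis.Complex_Analysis"
    "HOL-Homology.Homology"
    "HOL-Algebra.Algebra"
begin

section \<open>Hyperbolic geometry of the unit disc\<close>

abbreviation disc :: "complex set"
  where "disc \<equiv> ball 0 1"

text \<open>
  Orientation-preserving isometries are taken as extensional functions on the closed disc, so that
  they form a subset of \<^term>\<open>Bij (cball (0::complex) 1)\<close> and the same function acts on the open
  disc and on the boundary circle.
\<close>

definition disc_isometries :: "(complex \<Rightarrow> complex) set"
  where "disc_isometries = {restrict (Moebius_function t w) (cball 0 1) |t w. cmod w < 1}"

abbreviation closed_disc_Bij :: "(complex \<Rightarrow> complex) monoid"
  where "closed_disc_Bij \<equiv> BijGroup (cball 0 1)"

text \<open>The distance induced by the metric \<open>2|dz|/(1 - |z|^2)\<close>.\<close>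

definition hyp_dist :: "complex \<Rightarrow> complex \<Rightarrow> real"
  where "hyp_dist x y = 2 * artanh (cmod (Moebius_function 0 x y))"

text \<open>
  \<^term>\<open>Moebius_function 0 x\<close> is an isometry moving \<open>x\<close> to \<open>0\<close>, with inverse
  \<^term>\<open>Moebius_function 0 (-x)\<close>; geodesics through \<open>0\<close> are Euclidean diameters.
  Accordingly \<open>geo_path x y\<close> parametrises the geodesic segment from \<open>x\<close> to \<open>y\<close>, and
  \<open>geo_line x y\<close> is the complete geodesic through \<open>x\<close> and \<open>y\<close>, oriented from \<open>x\<close> towards \<open>y\<close>,
  with initial and terminal endpoint \<open>geo_start x y\<close> and \<open>geo_end x y\<close> on the unit circle
  (for \<open>x \<noteq> y\<close>).
\<close>

definition geo_path :: "complex \<Rightarrow> complex \<Rightarrow> real \<Rightarrow> complex"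
  where "geo_path x y s = Moebius_function 0 (-x) (s *\<^sub>R Moebius_function 0 x y)"

definition geo_segment :: "complex \<Rightarrow> complex \<Rightarrow> complex set"
  where "geo_segment x y = geo_path x y ` {0..1}"

definition geo_line :: "complex \<Rightarrow> complex \<Rightarrow> complex set"
  where "geo_line x y =
    (\<lambda>r. Moebius_function 0 (-x) (r *\<^sub>R sgn (Moebius_function 0 x y))) ` {-1<..<1}"

definition geo_start :: "complex \<Rightarrow> complex \<Rightarrow> complex"
  where "geo_start x y = Moebius_function 0 (-x) (- sgn (Moebius_function 0 x y))"

definition geo_end :: "complex \<Rightarrow> complex \<Rightarrow> complex"
  where "geo_end x y = Moebius_function 0 (-x) (sgn (Moebius_function 0 x y))"

text \<open>
  The angle at \<open>x\<close>, measured counter-clockwise, from the geodesic ray towards \<open>y\<close> to the one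
  towards \<open>z\<close>. (The derivative of \<^term>\<open>Moebius_function 0 x\<close> at \<open>x\<close> is a positive real.)
\<close>

definition geo_angle :: "complex \<Rightarrow> complex \<Rightarrow> complex \<Rightarrow> real"
  where "geo_angle x y z = Arg2pi (Moebius_function 0 x z / Moebius_function 0 x y)"


section \<open>Cocompact torsion-free Fuchsian groups\<close>

definition orbit_of :: "(complex \<Rightarrow> complex) set \<Rightarrow> complex \<Rightarrow> complex set"
  where "orbit_of \<Gamma> z = (\<lambda>\<gamma>. \<gamma> z) ` \<Gamma>"

text \<open>The quotient topology on the set of orbits of points of the open disc.\<close>

definition orbit_space :: "(complex \<Rightarrow> complex) set \<Rightarrow> complex set topology"
  where "orbit_space \<Gamma> = topology (\<lambda>U. U \<subseteq> orbit_of \<Gamma> ` disc \<and> open {z \<in> disc. orbit_of \<Gamma> z \<in> U})"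

lemma openin_orbit_space:
  "openin (orbit_space \<Gamma>) U \<longleftrightarrow>
    U \<subseteq> orbit_of \<Gamma> ` disc \<and> open {z \<in> disc. orbit_of \<Gamma> z \<in> U}"
proof -
  have "istopology (\<lambda>U. U \<subseteq> orbit_of \<Gamma> ` disc \<and> open {z \<in> disc. orbit_of \<Gamma> z \<in> U})"
    unfolding istopology_def
  proof (intro conjI allI impI)
    fix S T assume S: "S \<subseteq> orbit_of \<Gamma> ` disc \<and> open {z \<in> disc. orbit_of \<Gamma> z \<in> S}"
      and T: "T \<subseteq> orbit_of \<Gamma> ` disc \<and> open {z \<in> disc. orbit_of \<Gamma> z \<in> T}"
    show "S \<inter> T \<subseteq> orbit_of \<Gamma> ` disc" using S by blast
    have "{z \<in> disc. orbit_of \<Gamma> z \<in> S \<inter> T} =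
        {z \<in> disc. orbit_of \<Gamma> z \<in> S} \<inter> {z \<in> disc. orbit_of \<Gamma> z \<in> T}" by blast
    then show "open {z \<in> disc. orbit_of \<Gamma> z \<in> S \<inter> T}" using S T by auto
  next
    fix K assume K: "\<forall>S\<in>K. S \<subseteq> orbit_of \<Gamma> ` disc \<and> open {z \<in> disc. orbit_of \<Gamma> z \<in> S}"
    show "\<Union>K \<subseteq> orbit_of \<Gamma> ` disc" using K by blast
    have "{z \<in> disc. orbit_of \<Gamma> z \<in> \<Union>K} = (\<Union>S\<in>K. {z \<in> disc. orbit_of \<Gamma> z \<in> S})" by blast
    then show "open {z \<in> disc. orbit_of \<Gamma> z \<in> \<Union>K}" using K by auto
  qed
  then show ?thesis by (simp add: orbit_space_def)
qed

text \<open>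
  The genus of a closed orientable surface is half its first Betti number; the first homology
  group of such a surface is free abelian.
\<close>

definition has_genus :: "'a topology \<Rightarrow> nat \<Rightarrow> bool"
  where "has_genus S g \<longleftrightarrow> homology_group 1 S \<cong> free_Abelian_group {..<2 * g}"

text \<open>
  Discreteness refers to the topology of pointwise convergence on the closed disc, which on
  \<^term>\<open>disc_isometries\<close> coincides with the Lie group topology of \<open>PSU(1,1)\<close>.
\<close>

locale surface_group =
  fixes \<Gamma> :: "(complex \<Rightarrow> complex) set" and g :: nat
  assumes subgroup: "subgroup \<Gamma> closed_disc_Bij"
    and isometries: "\<Gamma> \<subseteq> disc_isometries"
    and discrete: "discrete \<Gamma>"
    and torsion_free: "\<And>\<gamma> n. \<gamma> \<in> \<Gamma> \<Longrightarrow> \<gamma> \<noteq> \<one>\<^bsub>closed_disc_Bij\<^esub> \<Longrightarrow> 0 < n \<Longrightarrow>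
          \<gamma> [^]\<^bsub>closed_disc_Bij\<^esub> (n::nat) \<noteq> \<one>\<^bsub>closed_disc_Bij\<^esub>"
    and free: "\<And>\<gamma> z. \<gamma> \<in> \<Gamma> \<Longrightarrow> \<gamma> \<noteq> \<one>\<^bsub>closed_disc_Bij\<^esub> \<Longrightarrow> z \<in> disc \<Longrightarrow> \<gamma> z \<noteq> z"
    and cocompact: "compact_space (orbit_space \<Gamma>)"
    and genus: "has_genus (orbit_space \<Gamma>) g"


section \<open>Marked fundamental polygons with \<open>8g - 4\<close> sides\<close>

text \<open>
  Families indexed modulo \<^term>\<open>num_sides g\<close> are \<^term>\<open>num_sides g\<close>-periodic functions on the
  integers. Since \<^term>\<open>num_sides g\<close> is even, parity of indices is well defined.
\<close>

definition num_sides :: "nat \<Rightarrow> int"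
  where "num_sides g = 8 * int g - 4"

definition periodic :: "int \<Rightarrow> (int \<Rightarrow> 'a) \<Rightarrow> bool"
  where "periodic N a \<longleftrightarrow> (\<forall>k. a (k + N) = a k)"

definition side_pairing :: "nat \<Rightarrow> int \<Rightarrow> int"
  where "side_pairing g k =
    (if odd k then (4 * int g - k) mod num_sides g else (2 - k) mod num_sides g)"

definition side_rho :: "nat \<Rightarrow> int \<Rightarrow> int"
  where "side_rho g k = side_pairing g k + 1"

definition side :: "(int \<Rightarrow> complex) \<Rightarrow> int \<Rightarrow> complex set"
  where "side V k = geo_segment (V k) (V (k + 1))"

definition side_extension :: "(int \<Rightarrow> complex) \<Rightarrow> int \<Rightarrow> complex set"
  where "side_extension V k = geo_line (V k) (V (k + 1))"

text \<open>The extension of side \<open>k\<close> runs from \<open>P k\<close> to \<open>Q (k + 1)\<close>.\<close>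

definition pt_P :: "(int \<Rightarrow> complex) \<Rightarrow> int \<Rightarrow> complex"
  where "pt_P V k = geo_start (V k) (V (k + 1))"

definition pt_Q :: "(int \<Rightarrow> complex) \<Rightarrow> int \<Rightarrow> complex"
  where "pt_Q V k = geo_end (V (k - 1)) (V k)"

definition internal_angle :: "(int \<Rightarrow> complex) \<Rightarrow> int \<Rightarrow> real"
  where "internal_angle V k = geo_angle (V k) (V (k + 1)) (V (k - 1))"

text \<open>
  The closed path running through \<open>V 0, V 1, \<dots>, V N = V 0\<close>, with side \<open>k\<close> traversed
  for parameters between \<open>k/N\<close> and \<open>(k+1)/N\<close>.
\<close>

definition polygon_path :: "int \<Rightarrow> (int \<Rightarrow> complex) \<Rightarrow> real \<Rightarrow> complex"
  where "polygon_path N V s =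
    geo_path (V \<lfloor>of_int N * s\<rfloor>) (V (\<lfloor>of_int N * s\<rfloor> + 1)) (frac (of_int N * s))"

definition polygon_region :: "int \<Rightarrow> (int \<Rightarrow> complex) \<Rightarrow> complex set"
  where "polygon_region N V =
    path_image (polygon_path N V) \<union> inside (path_image (polygon_path N V))"

definition fundamental_domain :: "(complex \<Rightarrow> complex) set \<Rightarrow> complex set \<Rightarrow> bool"
  where "fundamental_domain \<Gamma> F \<longleftrightarrow>
    (\<Union>\<gamma>\<in>\<Gamma>. \<gamma> ` F) = disc \<and>
    (\<forall>\<gamma>\<in>\<Gamma>. \<gamma> \<noteq> \<one>\<^bsub>closed_disc_Bij\<^esub> \<longrightarrow> interior F \<inter> interior (\<gamma> ` F) = {})"

text \<open>
  \<open>P 1, Q 1, P 2, Q 2, \<dots>, P N, Q N\<close> are pairwise distinct and in counter-clockwise order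
  on the circle: their arguments relative to \<open>P 1\<close> increase strictly.
\<close>

definition ccw_interlaced :: "int \<Rightarrow> (int \<Rightarrow> complex) \<Rightarrow> (int \<Rightarrow> complex) \<Rightarrow> bool"
  where "ccw_interlaced N P Q \<longleftrightarrow>
    (\<forall>k\<in>{1..N}. Arg2pi (P k / P 1) < Arg2pi (Q k / P 1)) \<and>
    (\<forall>k\<in>{1..<N}. Arg2pi (Q k / P 1) < Arg2pi (P (k + 1) / P 1))"

locale marked_fundamental_polygon = surface_group \<Gamma> g
  for \<Gamma> :: "(complex \<Rightarrow> complex) set" and g :: nat +
  fixes V :: "int \<Rightarrow> complex" and T :: "int \<Rightarrow> complex \<Rightarrow> complex"
  assumes periodic_V: "periodic (num_sides g) V"
    and V_in_disc: "\<And>k. V k \<in> disc"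
    and simple_polygon: "simple_path (polygon_path (num_sides g) V)"
    and counter_clockwise: "\<And>z. z \<in> inside (path_image (polygon_path (num_sides g) V)) \<Longrightarrow>
          winding_number (polygon_path (num_sides g) V) z = 1"
    and fundamental: "fundamental_domain \<Gamma> (polygon_region (num_sides g) V)"
    and side_lengths: "\<And>k. hyp_dist (V k) (V (k + 1)) =
          hyp_dist (V (side_pairing g k)) (V (side_pairing g k + 1))"
    and angle_sum: "\<And>k. internal_angle V k + internal_angle V (side_pairing g k + 1) = pi"
    and extension_condition: "\<And>k \<gamma>. \<gamma> \<in> \<Gamma> \<Longrightarrow>
          side_extension V k \<inter> interior (\<gamma> ` polygon_region (num_sides g) V) = {}"
    and endpoint_order: "ccw_interlaced (num_sides g) (pt_P V) (pt_Q V)"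
    and periodic_T: "periodic (num_sides g) T"
    and T_in: "\<And>k. T k \<in> \<Gamma>"
    and T_generate: "generate closed_disc_Bij (range T) = \<Gamma>"
    and T_side: "\<And>k. T k ` side V k = side V (side_pairing g k)"
    and T_vertex: "\<And>k. T k (V k) = V (side_rho g k)"
    and T_inverse: "\<And>k. T (side_pairing g k) \<otimes>\<^bsub>closed_disc_Bij\<^esub> T k = \<one>\<^bsub>closed_disc_Bij\<^esub>"
    and T_relation: "\<And>k. T ((side_rho g ^^ 3) k) \<otimes>\<^bsub>closed_disc_Bij\<^esub>
          (T ((side_rho g ^^ 2) k) \<otimes>\<^bsub>closed_disc_Bij\<^esub>
            (T (side_rho g k) \<otimes>\<^bsub>closed_disc_Bij\<^esub> T k)) = \<one>\<^bsub>closed_disc_Bij\<^esub>"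


section \<open>The boundary map\<close>

text \<open>
  The circle \<open>\<real>/2\<pi>\<int>\<close> is represented by the unit circle in the complex plane, with
  arc-length distance \<open>circle_dist\<close>. Arcs run counter-clockwise from \<open>a\<close> to \<open>b\<close>.
\<close>

definition circle_dist :: "complex \<Rightarrow> complex \<Rightarrow> real"
  where "circle_dist x y = \<bar>Arg (x / y)\<bar>"

definition ccw_arc :: "complex \<Rightarrow> complex \<Rightarrow> complex set"
  where "ccw_arc a b = {x \<in> sphere 0 1. Arg2pi (x / a) \<le> Arg2pi (b / a)}"

definition ccw_arc_half_open :: "complex \<Rightarrow> complex \<Rightarrow> complex set"
  where "ccw_arc_half_open a b = {x \<in> sphere 0 1. Arg2pi (x / a) < Arg2pi (b / a)}"

text \<open>
  The description is proper on the unit circle whenever the half-open arcs from \<open>A k\<close> to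
  \<open>A (k + 1)\<close>, for \<open>k\<close> from \<open>1\<close> to \<open>N\<close>, partition it.
\<close>

definition boundary_map ::
    "int \<Rightarrow> (int \<Rightarrow> complex \<Rightarrow> complex) \<Rightarrow> (int \<Rightarrow> complex) \<Rightarrow> complex \<Rightarrow> complex"
  where "boundary_map N T A x =
    T (THE k. k \<in> {1..N} \<and> x \<in> ccw_arc_half_open (A k) (A (k + 1))) x"


section \<open>Bowen's topological entropy\<close>

definition separated_set ::
    "'a set \<Rightarrow> ('a \<Rightarrow> 'a \<Rightarrow> real) \<Rightarrow> ('a \<Rightarrow> 'a) \<Rightarrow> nat \<Rightarrow> real \<Rightarrow> 'a set \<Rightarrow> bool"
  where "separated_set M d f n \<epsilon> E \<longleftrightarrow> E \<subseteq> M \<and>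
    (\<forall>x\<in>E. \<forall>y\<in>E. x \<noteq> y \<longrightarrow> (\<exists>i<n. d ((f ^^ i) x) ((f ^^ i) y) > \<epsilon>))"

text \<open>
  Subsets of separated sets are separated, so it suffices to consider finite ones; the value is
  \<open>\<infinity>\<close> if their cardinalities are unbounded.
\<close>

definition max_separated ::
    "'a set \<Rightarrow> ('a \<Rightarrow> 'a \<Rightarrow> real) \<Rightarrow> ('a \<Rightarrow> 'a) \<Rightarrow> nat \<Rightarrow> real \<Rightarrow> enat"
  where "max_separated M d f n \<epsilon> =
    (SUP E \<in> {E. finite E \<and> separated_set M d f n \<epsilon> E}. enat (card E))"

definition ln_enat :: "enat \<Rightarrow> ereal"
  where "ln_enat s = (case s of enat m \<Rightarrow> ereal (ln (real m)) | \<infinity> \<Rightarrow> \<infinity>)"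

definition topological_entropy :: "'a set \<Rightarrow> ('a \<Rightarrow> 'a \<Rightarrow> real) \<Rightarrow> ('a \<Rightarrow> 'a) \<Rightarrow> ereal"
  where "topological_entropy M d f =
    Lim (at_right 0) (\<lambda>\<epsilon>. limsup (\<lambda>n. ln_enat (max_separated M d f n \<epsilon>) / ereal (real n)))"

end

(*
  There is a "measure of maximal entropy" that every generator T k scales by the same factor lam on
  the whole arc [P k, Q (k + 1)], so that each boundary map has constant slope lam. It is built as a
  monotone function phi on the universal cover of the circle: prescribe mass 1 on each arc [P k, Q k]
  and lam - 1 on each arc [Q k, P (k + 1)], and pull back along the branches T k on [P k, P (k + 1)).
  The relation between four generators at a vertex shows that on the overlap [P k, Q k] the branch
  T (k - 1) scales phi by lam as well, and consistency of the masses forces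
  lam^2 - (8g - 6) lam + 1 = 0.

  Let c n be the number of monotone branches of the n-th iterate. Every branch is expanded by lam^n
  to a total mass of at most that of the circle, hence c n >= lam^n. Conversely an image arc meeting
  more than two of the arcs [A k, A (k + 1)) has mass at least lam - 1, hence
  c (n + 1) <= 2 c n + C lam^n, and since lam > 2 this gives c n <= C' lam^n. Finally, a separated set
  has at most linearly many points on each branch, and distinct branches are separated because
  the images of A k under T (k - 1) and T k are far apart.
*)
theory Submission
  imports Defs "HOL-Real_Asymp.Real_Asymp"
begin

text \<open>The obstacle is that \<open>A k\<close> is arbitrary in \<open>[P k, Q k]\<close>:
  either neighbouring branch may act on a point of that arc. A factor \<open>lam\<close> shared by
  both branches makes every count independent of the cuts. The counting sees \<open>phi\<close> only
  through monotonicity, the scaling law and the masses of the basic arcs, so an increasing limit of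
  step functions can serve as \<open>phi\<close>. Mass does not control arc length, so the linear
  bound on one branch comes from lengths: order is preserved along a branch and each image spans at
  most one turn, so the sum of \<open>n\<close> successive positions ranges over at most
  \<open>2 * pi * n\<close> and increases by more than \<open>e\<close> between points of a
  separated set. The genus enters twice: it makes \<open>lam > 2\<close>, so that the two truncated
  pieces per branch, which alone would give \<open>2 ^ n\<close>, stay below the main growth; and it
  gives at least 12 sides, which leaves room between the two images of a neighbourhood of a
  cut.\<close>

lemma int_step_strict_mono:
  fixes f :: "int \<Rightarrow> real"
  assumes "\<And>k. f k < f (k + 1)" and "i < j"
  shows "f i < f j"
  using \<open>i < j\<close>
proof (induction j rule: int_gr_induct)
  case base
  then show ?case by (rule assms(1))
next
  case (step j)
  then show ?case using assms(1)[of j] by linarith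
qed

section \<open>The constant slope coordinate\<close>

text \<open>Stated over a ring to serve both index shifts by \<open>N\<close> and angle shifts by
  \<open>2 * pi\<close>.\<close>

lemma shift_multiple:
  fixes f :: "'a::ring_1 \<Rightarrow> real"
  assumes "\<And>x. f (x + d) = f x + c"
  shows "f (x + d * of_int m) = f x + c * of_int m"
proof (induction m rule: int_induct[where k = 0])
  case (step1 m)
  then show ?case using assms[of "x + d * of_int m"] by (simp add: algebra_simps)
next
  case (step2 m)
  then show ?case using assms[of "x + d * of_int (m - 1)"] by (simp add: algebra_simps)
qed simp

lemma int_bracket:
  fixes f :: "int \<Rightarrow> real"
  assumes N: "N > 0" and c: "c > 0" and shift: "\<And>k. f (k + N) = f k + c"
  obtains k where "f k \<le> t" "t < f (k + 1)"
proof -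
  have mult: "f (m * N) = f 0 + of_int m * c" for m
    using shift_multiple[of f N c 0 m, OF shift] by (simp add: mult.commute)
  define m where "m = \<lfloor>(t - f 0) / c\<rfloor>"
  have "of_int m \<le> (t - f 0) / c" "(t - f 0) / c < of_int m + 1"
    unfolding m_def by linarith+
  then have "of_int m * c \<le> t - f 0" "t - f 0 < (of_int m + 1) * c"
    using c by (simp_all add: field_simps)
  then have lo: "f (m * N) \<le> t" and hi: "t < f (m * N + int (nat N))"
    using mult[of m] shift[of "m * N"] N by (simp_all add: algebra_simps)
  have "\<exists>k. f k \<le> t \<and> t < f (k + 1)" if "t < f (m * N + int n)" for n
    using that
  proof (induction n)
    case 0
    then show ?case using lo by simp
  next
    case (Suc n)
    show ?case
    proof (cases "t < f (m * N + int n)")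
      case False
      then show ?thesis
        using Suc.prems by (intro exI[of _ "m * N + int n"]) (simp add: algebra_simps)
    qed (use Suc.IH in simp)
  qed
  then show thesis using hi that by blast
qed

text \<open>Data on the universal cover. The indices \<open>s k\<close> are not reduced modulo
  \<open>N\<close>, and \<open>s\<close> turns a shift by \<open>N\<close> into a shift by
  \<open>-N\<close>; hence \<open>tau_add_N\<close> subtracts \<open>2 * pi\<close>. Each
  \<open>tau k\<close> is a lift normalised at \<open>p k\<close>, and the summand \<open>N\<close>
  in \<open>tau_p_next\<close> and \<open>tau_q_next\<close> picks the copy of the image within one
  turn to the right of \<open>q (s k + 1)\<close>. By \<open>s_step\<close>, neighbouring branches
  have images about half a circle apart.\<close>

locale boundary_lift =
  fixes N M :: int and s :: "int \<Rightarrow> int" and p q :: "int \<Rightarrow> real"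
    and tau :: "int \<Rightarrow> real \<Rightarrow> real" and lam :: real
  assumes N_eq: "N = 2 * M" and M_ge: "M \<ge> 6"
    and lam_gt: "lam > 2" and lam_eq: "lam * lam = (of_int N - 2) * lam - 1"
    and s_add_N: "\<And>k. s (k + N) = s k - N"
    and s_step: "\<And>k. s k = s (k + 1) + M + 1 \<or> s k = s (k + 1) + M + 1 - N"
    and p_less_q: "\<And>k. p k < q k" and q_less_p: "\<And>k. q k < p (k + 1)"
    and p_add_N: "\<And>k. p (k + N) = p k + 2 * pi" and q_add_N: "\<And>k. q (k + N) = q k + 2 * pi"
    and tau_mono: "\<And>k. strict_mono (tau k)" and tau_surj: "\<And>k. surj (tau k)"
    and tau_add_N: "\<And>k t. tau (k + N) (t + 2 * pi) = tau k t - 2 * pi"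
    and tau_p: "\<And>k. tau k (p k) = q (s k + 1)"
    and tau_q: "\<And>k. tau k (q k) = q (s k + 2)"
    and tau_p_next: "\<And>k. tau k (p (k + 1)) = p (s k - 1 + N)"
    and tau_q_next: "\<And>k. tau k (q (k + 1)) = p (s k + N)"
    and cocycle: "\<And>k. \<exists>c::int. \<forall>t. tau (s (k + 1) + 1) (tau (k + 1) t) =
          tau (s k - 1 + N) (tau k t) + 2 * pi * of_int c"
begin

lemma N_pos: "N > 0"
  using N_eq M_ge by simp

lemma p_less: "i < j \<Longrightarrow> p i < p j"
  by (rule int_step_strict_mono[of p, OF less_trans[OF p_less_q q_less_p]])

lemma q_less: "i < j \<Longrightarrow> q i < q j"
  by (rule int_step_strict_mono[of q, OF less_trans[OF q_less_p p_less_q]])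

lemma p_le: "i \<le> j \<Longrightarrow> p i \<le> p j"
  using p_less[of i j] by (cases "i = j") simp_all

lemma q_le: "i \<le> j \<Longrightarrow> q i \<le> q j"
  using q_less[of i j] by (cases "i = j") simp_all

lemma tau_less_iff [simp]: "tau k x < tau k y \<longleftrightarrow> x < y"
  by (rule strict_mono_less[OF tau_mono])

lemma tau_le_iff [simp]: "tau k x \<le> tau k y \<longleftrightarrow> x \<le> y"
  by (rule strict_mono_less_eq[OF tau_mono])

section \<open>Monotone functions with prescribed masses and their pullback\<close>

definition idx :: "real \<Rightarrow> int"
  where "idx t = (THE k. p k \<le> t \<and> t < p (k + 1))"

lemma idx_eq:
  assumes "p k \<le> t" "t < p (k + 1)"
  shows "idx t = k"
  unfolding idx_def
proof (rule the_equality)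
  fix j assume j: "p j \<le> t \<and> t < p (j + 1)"
  then have "p j < p (k + 1)" "p k < p (j + 1)"
    using assms by auto
  then have "\<not> k + 1 \<le> j" "\<not> j + 1 \<le> k"
    using p_le[of "k + 1" j] p_le[of "j + 1" k] by linarith+
  then show "j = k" by simp
qed (use assms in simp)

lemma idx_bounds: "p (idx t) \<le> t" "t < p (idx t + 1)"
proof -
  obtain k where "p k \<le> t" "t < p (k + 1)"
    using int_bracket[of N "2 * pi" p] N_pos p_add_N pi_gt_zero by auto
  then show "p (idx t) \<le> t" "t < p (idx t + 1)"
    using idx_eq by auto
qed

lemma idx_p [simp]: "idx (p k) = k"
  by (rule idx_eq) (simp_all add: p_less)

lemma idx_q [simp]: "idx (q k) = k"
  by (rule idx_eq) (simp_all add: p_less_q q_less_p less_imp_le)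

lemma idx_shift [simp]: "idx (t + 2 * pi) = idx t + N"
  using idx_bounds[of t] p_add_N[of "idx t"] p_add_N[of "idx t + 1"]
  by (intro idx_eq) (simp_all add: algebra_simps)

lemma idx_mono: "t \<le> u \<Longrightarrow> idx t \<le> idx u"
proof (rule ccontr)
  assume "t \<le> u" "\<not> idx t \<le> idx u"
  then have "idx u + 1 \<le> idx t" by simp
  then have "p (idx u + 1) \<le> p (idx t)" by (rule p_le)
  then show False using idx_bounds[of t] idx_bounds[of u] \<open>t \<le> u\<close> by linarith
qed

definition normalized :: "(real \<Rightarrow> real) \<Rightarrow> bool"
  where "normalized f \<longleftrightarrow> mono f \<and> (\<forall>k. f (p k) = lam * of_int k \<and> f (q k) = lam * of_int k + 1) \<and>
    (\<forall>t. f (t + 2 * pi) = f t + lam * of_int N)"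

text \<open>The scaling law solved for the value at \<open>t\<close>: in the cell of index
  \<open>k\<close>, the increment of \<open>f\<close> from \<open>tau k (p k) = q (s k + 1)\<close>
  to \<open>tau k t\<close> should be \<open>lam\<close> times the increment from \<open>p k\<close>
  to \<open>t\<close>.\<close>

definition pull :: "(real \<Rightarrow> real) \<Rightarrow> real \<Rightarrow> real"
  where "pull f t = lam * of_int (idx t) +
    (f (tau (idx t) t) - lam * of_int (s (idx t) + 1) - 1) / lam"

text \<open>The least normalized function; starting from it makes the iterates of
  \<open>pull\<close> increase.\<close>

definition step_fun :: "real \<Rightarrow> real"
  where "step_fun t = lam * of_int (idx t) + (if t < q (idx t) then 0 else 1)"

lemma normalized_p: "normalized f \<Longrightarrow> f (p k) = lam * of_int k"
  and normalized_q: "normalized f \<Longrightarrow> f (q k) = lam * of_int k + 1"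
  and normalized_mono: "normalized f \<Longrightarrow> t \<le> u \<Longrightarrow> f t \<le> f u"
  and normalized_shift: "normalized f \<Longrightarrow> f (t + 2 * pi) = f t + lam * of_int N"
  by (simp_all add: normalized_def monoD)

lemma monoI_idx:
  fixes f :: "real \<Rightarrow> real"
  assumes within: "\<And>t u. t \<le> u \<Longrightarrow> idx t = idx u \<Longrightarrow> f t \<le> f u"
    and lower: "\<And>t. lam * of_int (idx t) \<le> f t"
    and upper: "\<And>t. f t \<le> lam * of_int (idx t + 1)"
  shows "mono f"
proof (rule monoI)
  fix t u :: real assume "t \<le> u"
  show "f t \<le> f u"
  proof (cases "idx t = idx u")
    case False
    then have "idx t + 1 \<le> idx u" using idx_mono[OF \<open>t \<le> u\<close>] by simp
    then have "lam * of_int (idx t + 1) \<le> lam * of_int (idx u)"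
      using lam_gt by (intro mult_left_mono) simp_all
    then show ?thesis using lower[of u] upper[of t] by linarith
  qed (use within \<open>t \<le> u\<close> in blast)
qed

lemma normalized_step_fun: "normalized step_fun"
  unfolding normalized_def
proof (intro conjI allI)
  show "mono step_fun"
    by (rule monoI_idx) (use lam_gt in \<open>auto simp: step_fun_def algebra_simps\<close>)
  show "step_fun (t + 2 * pi) = step_fun t + lam * of_int N" for t
    by (simp add: step_fun_def q_add_N distrib_left)
qed (simp_all add: step_fun_def p_less_q)

lemma lam_pos: "lam > 0"
  using lam_gt by simp

lemma normalized_pull:
  assumes f: "normalized f"
  shows "normalized (pull f)"
  unfolding normalized_def
proof (intro conjI allI)
  show "mono (pull f)"
  proof (rule monoI_idx)
    fix t u :: real assume "t \<le> u" and eq: "idx t = idx u"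
    then have "f (tau (idx u) t) \<le> f (tau (idx u) u)"
      by (intro normalized_mono[OF f]) simp
    then show "pull f t \<le> pull f u"
      unfolding pull_def eq using lam_gt
      by (intro add_left_mono divide_right_mono diff_right_mono) simp_all
  next
    fix t
    let ?k = "idx t"
    have "tau ?k (p ?k) \<le> tau ?k t" "tau ?k t \<le> tau ?k (p (?k + 1))"
      using idx_bounds[of t] by simp_all
    then have "f (q (s ?k + 1)) \<le> f (tau ?k t)" "f (tau ?k t) \<le> f (p (s ?k - 1 + N))"
      unfolding tau_p tau_p_next using f by (simp_all add: normalized_mono)
    then have lo: "lam * of_int (s ?k + 1) + 1 \<le> f (tau ?k t)"
      and hi: "f (tau ?k t) \<le> lam * of_int (s ?k - 1 + N)"
      using f by (simp_all add: normalized_p normalized_q)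
    show "lam * of_int ?k \<le> pull f t"
      using lo lam_pos by (simp add: pull_def)
    \<comment> \<open>The image cell has mass \<open>(N - 2) * lam - 1\<close>, which
      \<open>lam_eq\<close> turns into \<open>lam * lam\<close>; so the pulled back values stay
      below the one prescribed at \<open>p (k + 1)\<close>.\<close>
    have "f (tau ?k t) - lam * of_int (s ?k + 1) - 1 \<le> lam * lam"
      using hi lam_eq by (simp add: algebra_simps)
    then have "(f (tau ?k t) - lam * of_int (s ?k + 1) - 1) / lam \<le> lam"
      using lam_pos by (simp add: pos_divide_le_eq)
    then show "pull f t \<le> lam * of_int (?k + 1)"
      by (simp add: pull_def algebra_simps)
  qed
  show "pull f (p k) = lam * of_int k" for k
    using f by (simp add: pull_def tau_p normalized_q)
  show "pull f (q k) = lam * of_int k + 1" for k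
    using f lam_pos by (simp add: pull_def tau_q normalized_q field_simps)
  show "pull f (t + 2 * pi) = pull f t + lam * of_int N" for t
  proof -
    have "f (tau (idx t) t - 2 * pi) = f (tau (idx t) t) - lam * of_int N"
      using normalized_shift[OF f, of "tau (idx t) t - 2 * pi"] by simp
    then show ?thesis
      unfolding pull_def idx_shift tau_add_N s_add_N by (simp add: algebra_simps)
  qed
qed

lemma step_fun_le:
  assumes f: "normalized f"
  shows "step_fun t \<le> f t"
proof (cases "t < q (idx t)")
  case True
  then show ?thesis
    using normalized_mono[OF f idx_bounds(1)[of t]] f by (simp add: step_fun_def normalized_p)
next
  case False
  then show ?thesis
    using normalized_mono[OF f, of "q (idx t)" t] f by (simp add: step_fun_def normalized_q)
qed

definition iter :: "nat \<Rightarrow> real \<Rightarrow> real"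
  where "iter n = (pull ^^ n) step_fun"

lemma normalized_iter: "normalized (iter n)"
  by (induction n) (simp_all add: iter_def normalized_step_fun normalized_pull)

lemma iter_Suc: "iter (Suc n) t = pull (iter n) t"
  by (simp add: iter_def)

lemma iter_le_Suc: "iter n t \<le> iter (Suc n) t"
proof (induction n arbitrary: t)
  case 0
  then show ?case
    using step_fun_le[OF normalized_iter[of 1]] by (simp add: iter_def)
next
  case (Suc n)
  then show ?case
    unfolding iter_Suc[of "Suc n"] iter_Suc[of n] pull_def
    using lam_pos by (simp add: divide_right_mono)
qed

lemma iter_le: "iter n t \<le> lam * of_int (idx t + 1)"
  using normalized_mono[OF normalized_iter, of t "p (idx t + 1)" n] idx_bounds(2)[of t]
  by (simp add: normalized_p[OF normalized_iter])

definition phi :: "real \<Rightarrow> real"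
  where "phi t = lim (\<lambda>n. iter n t)"

lemma iter_tendsto: "(\<lambda>n. iter n t) \<longlonglongrightarrow> phi t"
proof -
  have "incseq (\<lambda>n. iter n t)"
    by (rule incseq_SucI) (rule iter_le_Suc)
  moreover have "\<forall>n. iter n t \<le> lam * of_int (idx t + 1)"
    using iter_le by blast
  ultimately have "convergent (\<lambda>n. iter n t)"
    by (metis incseq_convergent convergentI)
  then show ?thesis
    by (simp add: phi_def convergent_LIMSEQ_iff)
qed

lemma phi_eqI: "(\<lambda>n. iter n t) \<longlonglongrightarrow> l \<Longrightarrow> phi t = l"
  using iter_tendsto LIMSEQ_unique by blast

lemma phi_p [simp]: "phi (p k) = lam * of_int k"
  by (rule phi_eqI) (simp add: normalized_p[OF normalized_iter])

lemma phi_q [simp]: "phi (q k) = lam * of_int k + 1"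
  by (rule phi_eqI) (simp add: normalized_q[OF normalized_iter])

lemma phi_mono: "t \<le> u \<Longrightarrow> phi t \<le> phi u"
  by (rule LIMSEQ_le[OF iter_tendsto iter_tendsto])
    (use normalized_mono[OF normalized_iter] in blast)

lemma phi_shift: "phi (t + 2 * pi) = phi t + lam * of_int N"
  by (rule phi_eqI)
    (auto intro!: tendsto_intros iter_tendsto simp: normalized_shift[OF normalized_iter])

lemma phi_shift_int: "phi (t + 2 * pi * of_int m) = phi t + lam * of_int N * of_int m"
  by (rule shift_multiple[where f = phi]) (rule phi_shift)

lemma phi_pull: "phi t = pull phi t"
proof (rule phi_eqI)
  have "(\<lambda>n. iter (Suc n) t) \<longlonglongrightarrow> pull phi t"
    unfolding iter_Suc pull_def by (intro tendsto_intros iter_tendsto) (use lam_pos in simp)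
  then show "(\<lambda>n. iter n t) \<longlonglongrightarrow> pull phi t"
    by (rule filterlim_sequentially_Suc[THEN iffD1])
qed

section \<open>Affinity of \<open>phi\<close> along neighbouring branches\<close>

text \<open>The additive constant forced by \<open>t = p k\<close>, where
  \<open>tau k t = q (s k + 1)\<close>.\<close>

definition offset :: "int \<Rightarrow> real"
  where "offset k = lam * of_int (s k + 1) + 1 - lam * lam * of_int k"

definition defect :: "int \<Rightarrow> real \<Rightarrow> real"
  where "defect k t = phi (tau k t) - lam * phi t - offset k"

text \<open>Inside the cell this is the fixed point equation. At \<open>p (k + 1)\<close> that
  equation already speaks of branch \<open>k + 1\<close>; there the prescribed values fit branch
  \<open>k\<close> because of \<open>lam_eq\<close>.\<close>

lemma defect_eq_0:
  assumes "p k \<le> t" "t \<le> p (k + 1)"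
  shows "defect k t = 0"
proof (cases "t = p (k + 1)")
  case True
  have "phi (tau k t) = lam * of_int (s k - 1 + N)"
    by (simp only: True tau_p_next phi_p)
  moreover have "phi t = lam * of_int (k + 1)"
    by (simp only: True phi_p)
  ultimately show ?thesis
    using lam_eq by (simp add: defect_def offset_def algebra_simps)
next
  case False
  then have k: "idx t = k" using assms by (intro idx_eq) simp_all
  show ?thesis
    using phi_pull[of t] lam_pos unfolding pull_def k
    by (simp add: defect_def offset_def field_simps)
qed

text \<open>
  On \<open>[p (k + 1), q (k + 1)]\<close> the branches \<open>k\<close> and \<open>k + 1\<close> are both available and agree
  after one more step, so a failure of affinity there is \<open>lam\<close> times smaller than
  another such failure; being bounded, it vanishes.
\<close>

lemma defect_step:
  assumes t: "p (k + 1) \<le> t" "t \<le> q (k + 1)"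
  shows "lam * defect k t = defect (s (k + 1) + 1) (tau (k + 1) t)"
proof -
  let ?m = "s (k + 1) + 1" and ?j = "s k - 1 + N"
  obtain c :: int where c: "\<And>u. tau ?m (tau (k + 1) u) = tau ?j (tau k u) + 2 * pi * of_int c"
    using cocycle by blast
  have eq: "lam * defect k u + (lam * offset k + offset ?j + lam * of_int N * of_int c) =
      defect ?m (tau (k + 1) u) + (lam * offset (k + 1) + offset ?m)"
    if u: "p (k + 1) \<le> u" "u \<le> q (k + 1)" for u
  proof -
    have "tau k (p (k + 1)) \<le> tau k u" "tau k u \<le> tau k (q (k + 1))"
      using u by simp_all
    then have "p ?j \<le> tau k u" "tau k u \<le> p (?j + 1)"
      unfolding tau_p_next tau_q_next by (simp_all add: algebra_simps)
    then have "defect ?j (tau k u) = 0" by (rule defect_eq_0)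
    moreover have "defect (k + 1) u = 0"
      using u q_less_p[of "k + 1"] by (intro defect_eq_0) simp_all
    moreover have "phi (tau ?m (tau (k + 1) u)) = phi (tau ?j (tau k u)) + lam * of_int N * of_int c"
      unfolding c phi_shift_int ..
    ultimately show ?thesis unfolding defect_def by (simp add: algebra_simps)
  qed
  \<comment> \<open>Both defects vanish at \<open>u = p (k + 1)\<close>, so the constants on the two
    sides agree and the unknown turn count \<open>c\<close> cancels.\<close>
  have p': "tau (k + 1) (p (k + 1)) = q ?m" by (rule tau_p)
  have "defect k (p (k + 1)) = 0" "defect ?m (q ?m) = 0"
    using p_less[of k "k + 1"] p_less_q[of ?m] q_less_p[of ?m]
    by (intro defect_eq_0; simp)+
  then have "lam * offset k + offset ?j + lam * of_int N * of_int c = lam * offset (k + 1) + offset ?m"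
    using eq[of "p (k + 1)"] p_less_q[of "k + 1"] unfolding p' by simp
  then show ?thesis using eq[OF t] by linarith
qed

lemma defect_bound:
  assumes "p k \<le> t" "t \<le> q (k + 1)"
  shows "\<bar>defect k t\<bar> \<le> lam / lam ^ n"
  using assms
proof (induction n arbitrary: k t)
  case 0
  show ?case
  proof (cases "t \<le> p (k + 1)")
    case False
    then have "p (k + 1) \<le> t" by simp
    \<comment> \<open>On the overlap, \<open>phi (tau k t)\<close> and
      \<open>lam * phi t + offset k\<close> lie in the same interval of length
      \<open>lam\<close>.\<close>
    then have "p (s k - 1 + N) \<le> tau k t" "tau k t \<le> p (s k + N)"
      unfolding tau_p_next[symmetric] tau_q_next[symmetric] using 0 by simp_all
    then have "phi (p (s k - 1 + N)) \<le> phi (tau k t)" "phi (tau k t) \<le> phi (p (s k + N))"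
      "phi (p (k + 1)) \<le> phi t" "phi t \<le> phi (q (k + 1))"
      using \<open>p (k + 1) \<le> t\<close> 0 by (simp_all only: phi_mono)
    then have "lam * of_int (s k - 1 + N) \<le> phi (tau k t)" "phi (tau k t) \<le> lam * of_int (s k + N)"
      and 1: "lam * of_int (k + 1) \<le> phi t" "phi t \<le> lam * of_int (k + 1) + 1"
      by (simp_all only: phi_p phi_q)
    moreover have "lam * (lam * of_int (k + 1)) \<le> lam * phi t"
      "lam * phi t \<le> lam * (lam * of_int (k + 1) + 1)"
      using lam_pos 1 by (intro mult_left_mono; simp)+
    moreover have "offset k = lam * of_int (s k - 1 + N) - lam * (lam * of_int (k + 1))"
      using lam_eq by (simp add: offset_def algebra_simps)
    ultimately show ?thesis
      unfolding defect_def by (simp add: abs_le_iff algebra_simps)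
  qed (use 0 lam_pos defect_eq_0 in simp)
next
  case (Suc n)
  show ?case
  proof (cases "t \<le> p (k + 1)")
    case False
    let ?m = "s (k + 1) + 1"
    \<comment> \<open>Branch \<open>k + 1\<close> sends the overlap into
      \<open>[q ?m, q (?m + 1)]\<close>, within the range of the induction hypothesis for
      \<open>?m\<close>.\<close>
    have "tau (k + 1) (p (k + 1)) \<le> tau (k + 1) t" "tau (k + 1) t \<le> tau (k + 1) (q (k + 1))"
      using False Suc.prems by simp_all
    then have "q ?m \<le> tau (k + 1) t" "tau (k + 1) t \<le> q (?m + 1)"
      unfolding tau_p tau_q by (simp_all add: add.assoc)
    then have "\<bar>defect ?m (tau (k + 1) t)\<bar> \<le> lam / lam ^ n"
      using p_less_q[of ?m] by (intro Suc.IH) simp_all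
    then have "\<bar>lam * defect k t\<bar> \<le> lam / lam ^ n"
      using defect_step[of k t] False Suc.prems by simp
    then show ?thesis using lam_pos by (simp add: abs_mult field_simps)
  qed (use Suc.prems lam_pos defect_eq_0 in simp)
qed

lemma phi_tau:
  assumes "p k \<le> t" "t \<le> q (k + 1)"
  shows "phi (tau k t) = lam * phi t + offset k"
proof -
  have "(\<lambda>n. lam * (1 / lam) ^ n) \<longlonglongrightarrow> lam * 0"
    using lam_gt by (intro tendsto_intros LIMSEQ_realpow_zero) simp_all
  then have "(\<lambda>n. lam / lam ^ n) \<longlonglongrightarrow> 0"
    by (simp add: power_one_over)
  then have "\<bar>defect k t\<bar> \<le> 0"
    using defect_bound[OF assms] by (intro LIMSEQ_le_const) auto
  then show ?thesis by (simp add: defect_def)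
qed

end

section \<open>Counting monotone branches\<close>

lemma cis_eq_cis_iff: "cis x = cis y \<longleftrightarrow> (\<exists>m::int. x = y + 2 * pi * of_int m)"
  using sin_cos_eq_iff[of x y] by (auto simp: complex_eq_iff)

lemma cis_eq_in_window:
  assumes "cis x = cis y" "a \<le> x" "x < a + 2 * pi" "a \<le> y" "y < a + 2 * pi"
  shows "x = y"
proof -
  obtain m :: int where m: "x = y + 2 * pi * of_int m" using assms(1) cis_eq_cis_iff by blast
  then have "2 * pi * of_int m < 2 * pi" "- (2 * pi) < 2 * pi * of_int m"
    using assms by linarith+
  then have "2 * pi * of_int m < 2 * pi * of_int 1" "2 * pi * of_int (- 1) < 2 * pi * of_int m"
    by simp_all
  then have "m < 1" "- 1 < m"
    unfolding mult_less_cancel_left_pos[OF mult_pos_pos[OF zero_less_numeral pi_gt_zero]] of_int_less_iff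
    by simp_all
  then show ?thesis using m by simp
qed

lemma sphere_eq_cis:
  assumes "z \<in> sphere 0 1"
  obtains t where "a \<le> t" "t < a + 2 * pi" "z = cis t"
proof -
  define m where "m = \<lfloor>(Arg z - a) / (2 * pi)\<rfloor>"
  have "z \<noteq> 0" "cmod z = 1" using assms by auto
  then have z: "z = cis (Arg z)" using cis_Arg[of z] by (simp add: sgn_eq)
  have m: "of_int m \<le> (Arg z - a) / (2 * pi)" "(Arg z - a) / (2 * pi) < of_int m + 1"
    unfolding m_def by linarith+
  show thesis
  proof (rule that)
    show "a \<le> Arg z - 2 * pi * of_int m" "Arg z - 2 * pi * of_int m < a + 2 * pi"
      using m by (simp_all add: field_simps)
    show "z = cis (Arg z - 2 * pi * of_int m)"
      using z cis_eq_cis_iff[of "Arg z" "Arg z - 2 * pi * of_int m"] by auto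
  qed
qed

lemma circle_dist_cis_le: "circle_dist (cis x) (cis y) \<le> \<bar>x - y\<bar>"
proof (cases "\<bar>x - y\<bar> < pi")
  case True
  then have "Arg (cis (x - y)) = x - y" by (intro Arg_cis) auto
  then show ?thesis by (simp add: circle_dist_def cis_divide)
next
  case False
  then show ?thesis
    using Arg_bounded[of "cis (x - y)"] by (simp add: circle_dist_def cis_divide abs_le_iff)
qed

lemma circle_dist_cis_le_iff:
  "circle_dist (cis x) (cis y) \<le> e \<longleftrightarrow> (\<exists>m::int. \<bar>x - y - 2 * pi * of_int m\<bar> \<le> e)"
proof
  assume "circle_dist (cis x) (cis y) \<le> e"
  moreover have "cis (x - y) = cis (Arg (cis (x - y)))"
    using cis_Arg[of "cis (x - y)"] by (simp add: sgn_eq)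
  then obtain m :: int where "x - y = Arg (cis (x - y)) + 2 * pi * of_int m"
    unfolding cis_eq_cis_iff by blast
  ultimately show "\<exists>m::int. \<bar>x - y - 2 * pi * of_int m\<bar> \<le> e"
    by (intro exI[of _ m]) (simp add: circle_dist_def cis_divide)
next
  assume "\<exists>m::int. \<bar>x - y - 2 * pi * of_int m\<bar> \<le> e"
  then obtain m :: int where m: "\<bar>x - (y + 2 * pi * of_int m)\<bar> \<le> e"
    by (auto simp: algebra_simps)
  have "cis (y + 2 * pi * of_int m) = cis y"
    using cis_eq_cis_iff by blast
  then show "circle_dist (cis x) (cis y) \<le> e"
    using circle_dist_cis_le[of x "y + 2 * pi * of_int m"] m by simp
qed

text \<open>\<open>Arg\<close> fails to be odd on the negative axis, so symmetry is read off the
  description by integer turns.\<close>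

lemma circle_dist_cis_commute: "circle_dist (cis x) (cis y) = circle_dist (cis y) (cis x)"
proof -
  have "circle_dist (cis y) (cis x) \<le> e" if le: "circle_dist (cis x) (cis y) \<le> e" for x y e
  proof -
    obtain m :: int where "\<bar>x - y - 2 * pi * of_int m\<bar> \<le> e"
      using le unfolding circle_dist_cis_le_iff by blast
    then have "\<bar>y - x - 2 * pi * of_int (- m)\<bar> \<le> e" by simp
    then show ?thesis unfolding circle_dist_cis_le_iff by blast
  qed
  then show ?thesis by (metis antisym order_refl)
qed

lemma sum_int_telescope:
  fixes F :: "int \<Rightarrow> real"
  assumes "j \<le> i"
  shows "(\<Sum>k\<in>{j..<i}. F (k + 1) - F k) = F i - F j"
  using assms
proof (induction i rule: int_ge_induct)
  case (step i)
  then have "{j..<i + 1} = insert i {j..<i}" by auto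
  then show ?case using step by simp
qed simp

text \<open>Pigeonhole: each cell of length \<open>e\<close> holds at most one value of
  \<open>h\<close>.\<close>

lemma card_gaps_le:
  fixes h :: "'a::linorder \<Rightarrow> real"
  assumes "finite E" "e > 0" "B \<ge> 0" and h: "\<And>x. x \<in> E \<Longrightarrow> c \<le> h x \<and> h x \<le> c + B"
    and gap: "\<And>x y. x \<in> E \<Longrightarrow> y \<in> E \<Longrightarrow> x < y \<Longrightarrow> h y - h x > e"
  shows "real (card E) \<le> B / e + 1"
proof -
  define k where "k x = nat \<lfloor>(h x - c) / e\<rfloor>" for x
  have k: "real (k x) \<le> (h x - c) / e" "(h x - c) / e < real (k x) + 1" if "x \<in> E" for x
  proof -
    have "0 \<le> (h x - c) / e" using h[OF that] \<open>e > 0\<close> by simp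
    then show "real (k x) \<le> (h x - c) / e" "(h x - c) / e < real (k x) + 1"
      unfolding k_def by linarith+
  qed
  have lt: "k x < k y" if "x \<in> E" "y \<in> E" "x < y" for x y
  proof -
    have "(h y - c) / e - (h x - c) / e = (h y - h x) / e"
      by (simp add: diff_divide_distrib)
    moreover have "(h y - h x) / e > 1"
      using gap[OF that] \<open>e > 0\<close> by simp
    ultimately have "(h y - c) / e - (h x - c) / e > 1" by simp
    then have "real (k x) < real (k y)"
      using k(1)[OF that(1)] k(2)[OF that(2)] by linarith
    then show ?thesis by simp
  qed
  have "inj_on k E"
    by (intro inj_onI) (metis lt less_irrefl neqE)
  moreover have "k ` E \<subseteq> {..nat \<lfloor>B / e\<rfloor>}"
  proof (rule image_subsetI)
    fix x assume "x \<in> E"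
    then have "real (k x) \<le> B / e"
      using k(1)[of x] h[of x] divide_right_mono[of "h x - c" B e] \<open>e > 0\<close> by linarith
    then show "k x \<in> {..nat \<lfloor>B / e\<rfloor>}" by (simp add: le_nat_floor)
  qed
  ultimately have "card E \<le> card {..nat \<lfloor>B / e\<rfloor>}"
    by (intro card_inj_on_le) simp_all
  moreover have "real (nat \<lfloor>B / e\<rfloor>) \<le> B / e"
    using assms by (simp add: of_nat_floor)
  ultimately show ?thesis by simp
qed

lemma periodic_pos_lower_bound:
  fixes F :: "int \<Rightarrow> real"
  assumes N: "N > 0" and per: "\<And>k. F (k + N) = F k" and pos: "\<And>k. F k > 0"
  obtains e where "e > 0" "\<And>k. e < F k"
proof -
  define m where "m = Min (F ` {0..<N})"
  have fin: "finite (F ` {0..<N})" "F ` {0..<N} \<noteq> {}" using N by auto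
  have "m > 0" unfolding m_def using fin pos by (subst Min_gr_iff) auto
  have "F (k + N * i) = F k" for k i
    using shift_multiple[of F N 0 k i] per by simp
  then have "F k = F (k mod N)" for k
    by (metis mult_div_mod_eq add.commute)
  moreover have "m \<le> F (k mod N)" for k
    unfolding m_def using fin N by (intro Min_le) auto
  ultimately have "m / 2 < F k" for k
    using \<open>m > 0\<close> by (metis field_sum_of_halves less_add_same_cancel1 half_gt_zero less_le_trans)
  then show thesis using that[of "m / 2"] \<open>m > 0\<close> by simp
qed

section \<open>Branches of the iterates and their mass\<close>

locale boundary_dynamics = boundary_lift +
  fixes alpha :: "int \<Rightarrow> real" and f :: "complex \<Rightarrow> complex"
  assumes p_le_alpha: "\<And>k. p k \<le> alpha k" and alpha_le_q: "\<And>k. alpha k \<le> q k"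
    and alpha_add_N: "\<And>k. alpha (k + N) = alpha k + 2 * pi"
    and f_cis: "\<And>k t. alpha k \<le> t \<Longrightarrow> t < alpha (k + 1) \<Longrightarrow> f (cis t) = cis (tau k t)"
begin

lemma alpha_less: "i < j \<Longrightarrow> alpha i < alpha j"
proof (rule int_step_strict_mono[of alpha])
  show "alpha k < alpha (k + 1)" for k
    using alpha_le_q[of k] q_less_p[of k] p_le_alpha[of "k + 1"] by linarith
qed

lemma alpha_le: "i \<le> j \<Longrightarrow> alpha i \<le> alpha j"
  using alpha_less[of i j] by (cases "i = j") simp_all

text \<open>Within one period of the cuts, different pieces have indices that differ modulo
  \<open>N\<close>, so they are different arcs of the circle.\<close>

definition window :: "real \<Rightarrow> real \<Rightarrow> bool"
  where "window l r \<longleftrightarrow> l < r \<and> (\<exists>j. alpha j \<le> l \<and> r \<le> alpha (j + N))"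

definition pieces :: "real \<Rightarrow> real \<Rightarrow> int set"
  where "pieces l r = {k. alpha k < r \<and> l < alpha (k + 1)}"

text \<open>Counts the branch itineraries of length \<open>n\<close> occurring on
  \<open>[l, r)\<close>, that is, the monotone branches of the \<open>n\<close>-th iterate; the
  interval is an argument because each piece is followed into its image.\<close>

primrec laps :: "nat \<Rightarrow> real \<Rightarrow> real \<Rightarrow> nat"
  where
    "laps 0 = (\<lambda>l r. 1)"
  | "laps (Suc n) = (\<lambda>l r. \<Sum>k\<in>pieces l r.
      laps n (tau k (max l (alpha k))) (tau k (min r (alpha (k + 1)))))"

lemma pieces_subset:
  assumes "alpha j \<le> l" "r \<le> alpha i"
  shows "pieces l r \<subseteq> {j..<i}"
proof
  fix k assume "k \<in> pieces l r"
  then have k: "alpha k < r" "l < alpha (k + 1)" by (simp_all add: pieces_def)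
  have "\<not> k + 1 \<le> j" "\<not> i \<le> k"
    using assms k alpha_le[of "k + 1" j] alpha_le[of i k] by linarith+
  then show "k \<in> {j..<i}" by simp
qed

lemma finite_pieces: "window l r \<Longrightarrow> finite (pieces l r)"
  unfolding window_def using finite_subset[OF pieces_subset] by blast

lemma window_length:
  assumes "window l r"
  shows "r - l \<le> 2 * pi" "phi r - phi l \<le> lam * of_int N" "l < r"
proof -
  obtain j where j: "alpha j \<le> l" "r \<le> alpha j + 2 * pi"
    using assms by (auto simp: window_def alpha_add_N)
  then show "r - l \<le> 2 * pi" by simp
  show "phi r - phi l \<le> lam * of_int N"
    using phi_mono[OF j(1)] phi_mono[OF j(2)] phi_shift[of "alpha j"] by linarith
  show "l < r" using assms by (simp add: window_def)
qed

lemma sum_pieces: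
  assumes "window l r"
  shows "(\<Sum>k\<in>pieces l r. phi (min r (alpha (k + 1))) - phi (max l (alpha k))) = phi r - phi l"
proof -
  obtain j where j: "alpha j \<le> l" "r \<le> alpha (j + N)" and "l < r"
    using assms by (auto simp: window_def)
  \<comment> \<open>Clamping to \<open>[l, r]\<close> makes the indices outside
    \<open>pieces l r\<close> contribute zero, so the sum over a full period telescopes.\<close>
  define G where "G k = phi (max l (min r (alpha k)))" for k
  have "(\<Sum>k\<in>pieces l r. phi (min r (alpha (k + 1))) - phi (max l (alpha k))) =
      (\<Sum>k\<in>pieces l r. G (k + 1) - G k)"
    using \<open>l < r\<close> by (intro sum.cong) (auto simp: pieces_def G_def)
  also have "\<dots> = (\<Sum>k\<in>{j..<j + N}. G (k + 1) - G k)"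
  proof (rule sum.mono_neutral_left)
    show "\<forall>k\<in>{j..<j + N} - pieces l r. G (k + 1) - G k = 0"
    proof
      fix k assume "k \<in> {j..<j + N} - pieces l r"
      then have "r \<le> alpha k \<or> alpha (k + 1) \<le> l" by (auto simp: pieces_def)
      then show "G (k + 1) - G k = 0"
        using alpha_le[of k "k + 1"] by (auto simp: G_def)
    qed
  qed (use pieces_subset[OF j] in simp_all)
  also have "\<dots> = G (j + N) - G j"
    using N_pos by (intro sum_int_telescope) simp
  also have "\<dots> = phi r - phi l"
    using j \<open>l < r\<close> by (simp add: G_def)
  finally show ?thesis .
qed

text \<open>No branch overlaps itself around the circle: its image stays in
  \<open>[q (s k + 1), p (s k + N)]\<close>, inside the period of cuts that starts at
  \<open>alpha (s k + 1)\<close>.\<close>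

lemma window_child:
  assumes "l < r" "k \<in> pieces l r"
  shows "window (tau k (max l (alpha k))) (tau k (min r (alpha (k + 1))))"
proof -
  let ?j = "s k + 1"
  have "max l (alpha k) < min r (alpha (k + 1))"
    using assms alpha_less[of k "k + 1"] by (simp add: pieces_def)
  moreover have "tau k (p k) \<le> tau k (max l (alpha k))"
    using p_le_alpha[of k] by simp
  then have "alpha ?j \<le> tau k (max l (alpha k))"
    unfolding tau_p using alpha_le_q[of ?j] by linarith
  moreover have "tau k (min r (alpha (k + 1))) \<le> tau k (q (k + 1))"
    using alpha_le_q[of "k + 1"] by simp
  then have "tau k (min r (alpha (k + 1))) \<le> alpha (?j + N)"
    unfolding tau_q_next using p_le_alpha[of "s k + N"] alpha_le[of "s k + N" "?j + N"] by simp
  ultimately show ?thesis unfolding window_def by auto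
qed

lemma phi_child:
  assumes "l < r" "k \<in> pieces l r"
  shows "phi (tau k (min r (alpha (k + 1)))) - phi (tau k (max l (alpha k))) =
    lam * (phi (min r (alpha (k + 1))) - phi (max l (alpha k)))"
proof -
  have "max l (alpha k) < min r (alpha (k + 1))"
    using assms alpha_less[of k "k + 1"] by (simp add: pieces_def)
  then have "p k \<le> max l (alpha k)" "max l (alpha k) \<le> q (k + 1)"
    "p k \<le> min r (alpha (k + 1))" "min r (alpha (k + 1)) \<le> q (k + 1)"
    using p_le_alpha[of k] alpha_le_q[of "k + 1"] by linarith+
  then show ?thesis by (simp add: phi_tau algebra_simps)
qed

lemma card_pieces_le:
  assumes w: "window l r"
  shows "real (card (pieces l r)) \<le> 2 + (phi r - phi l) / (lam - 1)"
proof -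
  let ?K = "pieces l r"
  \<comment> \<open>At most one piece is cut by \<open>l\<close> and at most one by
    \<open>r\<close>; every other piece contains \<open>[q k, p (k + 1)]\<close>, which has mass
    \<open>lam - 1\<close>.\<close>
  define lo where "lo = Set.filter (\<lambda>k. alpha k < l) ?K"
  define hi where "hi = Set.filter (\<lambda>k. r < alpha (k + 1)) ?K"
  define mid where "mid = ?K - lo - hi"
  have fin: "finite ?K" "finite lo" "finite hi"
    using finite_pieces[OF w] by (simp_all add: lo_def hi_def)
  have "\<not> j + 1 \<le> k" if "j \<in> lo" "k \<in> lo" for j k
    using that alpha_le[of "j + 1" k] by (auto simp: lo_def pieces_def)
  then have "card lo \<le> Suc 0"
    unfolding card_le_Suc0_iff_eq[OF fin(2)] by (metis linorder_neqE add1_zle_eq)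
  moreover have "\<not> j + 1 \<le> k" if "j \<in> hi" "k \<in> hi" for j k
    using that alpha_le[of "j + 1" k] by (auto simp: hi_def pieces_def)
  then have "card hi \<le> Suc 0"
    unfolding card_le_Suc0_iff_eq[OF fin(3)] by (metis linorder_neqE add1_zle_eq)
  moreover have "card ?K \<le> card (lo \<union> hi) + card mid" "card (lo \<union> hi) \<le> card lo + card hi"
  proof -
    have "?K = lo \<union> hi \<union> mid" by (auto simp: mid_def lo_def hi_def)
    then show "card ?K \<le> card (lo \<union> hi) + card mid"
      by (metis card_Un_le)
  qed (rule card_Un_le)
  ultimately have 1: "real (card ?K) \<le> 2 + real (card mid)" by linarith
  have "real (card mid) * (lam - 1) =
      (\<Sum>k\<in>mid. lam - 1)" by simp
  also have "\<dots> \<le> (\<Sum>k\<in>mid. phi (min r (alpha (k + 1))) - phi (max l (alpha k)))"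
  proof (rule sum_mono)
    fix k assume "k \<in> mid"
    then have "min r (alpha (k + 1)) = alpha (k + 1)" "max l (alpha k) = alpha k"
      by (auto simp: mid_def lo_def hi_def)
    moreover have "lam * of_int (k + 1) \<le> phi (alpha (k + 1))" "phi (alpha k) \<le> lam * of_int k + 1"
      using phi_mono[OF p_le_alpha[of "k + 1"]] phi_mono[OF alpha_le_q[of k]] by simp_all
    ultimately show "lam - 1 \<le> phi (min r (alpha (k + 1))) - phi (max l (alpha k))"
      by (simp add: algebra_simps)
  qed
  also have "\<dots> \<le> (\<Sum>k\<in>?K. phi (min r (alpha (k + 1))) - phi (max l (alpha k)))"
  proof (rule sum_mono2[OF fin(1)])
    fix k assume "k \<in> ?K - mid"
    then have "max l (alpha k) \<le> min r (alpha (k + 1))"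
      using w alpha_le[of k "k + 1"] by (auto simp: pieces_def window_def)
    then show "0 \<le> phi (min r (alpha (k + 1))) - phi (max l (alpha k))"
      using phi_mono by simp
  qed (auto simp: mid_def)
  also have "\<dots> = phi r - phi l" by (rule sum_pieces[OF w])
  finally have "real (card mid) \<le> (phi r - phi l) / (lam - 1)"
    using lam_gt by (simp add: pos_le_divide_eq)
  then show ?thesis using 1 by linarith
qed

lemma laps_ge:
  "window l r \<Longrightarrow> lam ^ n * (phi r - phi l) \<le> lam * of_int N * real (laps n l r)"
proof (induction n arbitrary: l r)
  case 0
  then show ?case using window_length(2) by simp
next
  case (Suc n)
  have lt: "l < r" using Suc.prems by (rule window_length)
  have "lam ^ Suc n * (phi r - phi l) =
      (\<Sum>k\<in>pieces l r. lam ^ n * (phi (tau k (min r (alpha (k + 1)))) - phi (tau k (max l (alpha k)))))"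
    unfolding sum_pieces[OF Suc.prems, symmetric]
    by (simp add: phi_child[OF lt] sum_distrib_left algebra_simps)
  also have "\<dots> \<le> (\<Sum>k\<in>pieces l r. lam * of_int N *
      real (laps n (tau k (max l (alpha k))) (tau k (min r (alpha (k + 1))))))"
    by (intro sum_mono Suc.IH window_child[OF lt])
  finally show ?case by (simp add: sum_distrib_left)
qed

text \<open>Two possibly truncated pieces double the first term; full pieces are paid for by mass.
  The coefficient of the mass therefore solves
  \<open>v (Suc n) = lam * v n + 2 ^ n / (lam - 1)\<close> with \<open>v 0 = 0\<close>.\<close>

lemma laps_le:
  "window l r \<Longrightarrow>
    real (laps n l r) \<le> 2 ^ n + (lam ^ n - 2 ^ n) / ((lam - 1) * (lam - 2)) * (phi r - phi l)"
proof (induction n arbitrary: l r)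
  case (Suc n)
  define v where "v n = (lam ^ n - 2 ^ n) / ((lam - 1) * (lam - 2))" for n
  have lt: "l < r" using Suc.prems by (rule window_length)
  have "real (laps (Suc n) l r) \<le> (\<Sum>k\<in>pieces l r. 2 ^ n +
      v n * (phi (tau k (min r (alpha (k + 1)))) - phi (tau k (max l (alpha k)))))"
    unfolding laps.simps of_nat_sum v_def by (intro sum_mono Suc.IH window_child[OF lt])
  also have "\<dots> = real (card (pieces l r)) * 2 ^ n + v n * lam * (phi r - phi l)"
    unfolding sum_pieces[OF Suc.prems, symmetric]
    by (simp add: phi_child[OF lt] sum.distrib sum_distrib_left mult.assoc)
  also have "\<dots> \<le> (2 + (phi r - phi l) / (lam - 1)) * 2 ^ n + v n * lam * (phi r - phi l)"
    by (intro add_right_mono mult_right_mono card_pieces_le[OF Suc.prems]) simp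
  also have "\<dots> = 2 ^ Suc n + (2 ^ n / (lam - 1) + v n * lam) * (phi r - phi l)"
    by (simp add: distrib_right)
  also have "2 ^ n / (lam - 1) + v n * lam = v (Suc n)"
    using lam_gt by (simp add: v_def divide_simps) (simp add: algebra_simps)
  finally show ?case by (simp add: v_def)
qed simp

end

section \<open>Separated sets compared with branches\<close>

context boundary_dynamics
begin

definition tau_inv :: "int \<Rightarrow> real \<Rightarrow> real"
  where "tau_inv k = inv_into UNIV (tau k)"

lemma inv_tau [simp]: "tau_inv k (tau k x) = x" "tau k (tau_inv k x) = x"
  unfolding tau_inv_def using strict_mono_imp_inj_on[OF tau_mono[of k], of UNIV] tau_surj[of k]
  by (simp_all add: inv_f_f surj_f_inv_f)

text \<open>
  The function \<open>h\<close> accumulates the positions along the orbit so far; since it increases by more than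
  \<open>e\<close> between any two points already separated, only its total range matters at the end.
\<close>

lemma card_separated_le:
  assumes "window l r" "finite E" "E \<subseteq> {l..<r}" "e > 0" "B \<ge> 0"
    and "\<And>x. x \<in> E \<Longrightarrow> c \<le> h x \<and> h x \<le> c + B"
    and "\<And>x y. x \<in> E \<Longrightarrow> y \<in> E \<Longrightarrow> x < y \<Longrightarrow> h x \<le> h y"
    and "\<And>x y. x \<in> E \<Longrightarrow> y \<in> E \<Longrightarrow> x < y \<Longrightarrow>
      h y - h x > e \<or> (\<exists>i<n. circle_dist ((f ^^ i) (cis x)) ((f ^^ i) (cis y)) > e)"
  shows "real (card E) \<le> real (laps n l r) * ((B + 2 * pi * real n) / e + 1)"
  using assms
proof (induction n arbitrary: l r E B c h)
  case 0
  then show ?case using card_gaps_le[of E e B c h] by simp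
next
  case (Suc n)
  note w = Suc.prems(1) and E = Suc.prems(2,3) and e = Suc.prems(4) and B = Suc.prems(5)
    and h = Suc.prems(6) and mono = Suc.prems(7) and sep = Suc.prems(8)
  have lt: "l < r" and len: "r - l \<le> 2 * pi" using window_length[OF w] by simp_all
  define P where "P k = E \<inter> {alpha k..<alpha (k + 1)}" for k
  let ?l = "\<lambda>k. tau k (max l (alpha k))" and ?r = "\<lambda>k. tau k (min r (alpha (k + 1)))"
  let ?C = "(B + 2 * pi + 2 * pi * real n) / e + 1"
  have "E \<subseteq> (\<Union>k\<in>pieces l r. P k)"
  proof
    fix x assume "x \<in> E"
    obtain k where "alpha k \<le> x" "x < alpha (k + 1)"
      using int_bracket[of N "2 * pi" alpha] N_pos alpha_add_N pi_gt_zero by auto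
    moreover have "l \<le> x" "x < r" using E \<open>x \<in> E\<close> by auto
    ultimately have "k \<in> pieces l r" "x \<in> P k"
      using \<open>x \<in> E\<close> by (auto simp: pieces_def P_def)
    then show "x \<in> (\<Union>k\<in>pieces l r. P k)" by blast
  qed
  then have "card E \<le> card (\<Union>k\<in>pieces l r. P k)"
    using finite_pieces[OF w] E by (intro card_mono) (auto simp: P_def)
  also have "\<dots> \<le> (\<Sum>k\<in>pieces l r. card (P k))"
    by (rule card_UN_le[OF finite_pieces[OF w]])
  finally have "real (card E) \<le> (\<Sum>k\<in>pieces l r. real (card (P k)))"
    by (metis of_nat_le_iff of_nat_sum)
  also have "\<dots> \<le> (\<Sum>k\<in>pieces l r. real (laps n (?l k) (?r k)) * ?C)"
  proof (rule sum_mono)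
    fix k assume k: "k \<in> pieces l r"
    \<comment> \<open>The induction hypothesis concerns the points \<open>tau k x\<close>, hence the
      detour through \<open>tau_inv\<close>. The added position stays in \<open>[l, r)\<close>, so
      the range grows by at most \<open>2 * pi\<close>.\<close>
    define h' where "h' y = h (tau_inv k y) + tau_inv k y" for y
    have h'_tau: "h' (tau k x) = h x + x" for x
      by (simp add: h'_def)
    have "inj_on (tau k) (P k)"
      using tau_mono by (intro strict_mono_imp_inj_on)
    then have "card (P k) = card (tau k ` P k)"
      by (simp add: card_image)
    moreover have "real (card (tau k ` P k)) \<le> real (laps n (?l k) (?r k)) * ?C"
    proof (rule Suc.IH[OF window_child[OF lt k], where c = "c + l" and h = h'])
      show "finite (tau k ` P k)" using E by (simp add: P_def)
      show "tau k ` P k \<subseteq> {?l k..<?r k}" using E by (auto simp: P_def)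
      show "0 < e" "0 \<le> B + 2 * pi" using e B by simp_all
    next
      fix y assume "y \<in> tau k ` P k"
      then obtain x where x: "x \<in> E" "y = tau k x" by (auto simp: P_def)
      then have "l \<le> x" "x < r" using E by auto
      then show "c + l \<le> h' y \<and> h' y \<le> c + l + (B + 2 * pi)"
        using h[OF x(1)] len unfolding x h'_tau by linarith
    next
      fix y y' assume "y \<in> tau k ` P k" "y' \<in> tau k ` P k" and "y < y'"
      then obtain x x' where x: "x \<in> E" "y = tau k x" and x': "x' \<in> E" "y' = tau k x'"
        and P: "x \<in> P k" "x' \<in> P k" by (auto simp: P_def)
      have "x < x'" using \<open>y < y'\<close> by (simp add: x x')
      note le = mono[OF x(1) x'(1) \<open>x < x'\<close>]
      then show "h' y \<le> h' y'"
        unfolding x x' h'_tau using \<open>x < x'\<close> by simp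
      have f: "f (cis x) = cis y" "f (cis x') = cis y'"
        using P by (simp_all add: P_def f_cis x x')
      from sep[OF x(1) x'(1) \<open>x < x'\<close>]
      show "h' y' - h' y > e \<or>
        (\<exists>i<n. circle_dist ((f ^^ i) (cis y)) ((f ^^ i) (cis y')) > e)"
      proof (elim disjE exE conjE)
        assume "h x' - h x > e"
        then show ?thesis unfolding x x' h'_tau using \<open>x < x'\<close> by simp
      next
        fix i assume i: "i < Suc n" "circle_dist ((f ^^ i) (cis x)) ((f ^^ i) (cis x')) > e"
        show ?thesis
        proof (cases i)
          case 0
          then have "\<bar>x - x'\<bar> > e"
            using i circle_dist_cis_le[of x x'] by simp
          then show ?thesis unfolding x x' h'_tau using le \<open>x < x'\<close> by simp
        next
          case (Suc i')
          then show ?thesis using i by (auto simp: funpow_Suc_right f simp del: funpow.simps)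
        qed
      qed
    qed
    ultimately show "real (card (P k)) \<le> real (laps n (?l k) (?r k)) * ?C" by simp
  qed
  also have "\<dots> = real (laps (Suc n) l r) * ?C"
    by (simp only: laps.simps of_nat_sum sum_distrib_right)
  also have "?C = (B + 2 * pi * real (Suc n)) / e + 1"
    by (simp add: algebra_simps)
  finally show ?case .
qed

text \<open>Divisibility replaces equality because \<open>x\<close> and \<open>y\<close> are lifts:
  pieces whose indices differ by a multiple of \<open>N\<close> are the same arc.\<close>

definition separates_pieces :: "real \<Rightarrow> bool"
  where "separates_pieces e \<longleftrightarrow> (\<forall>x y k j. alpha k \<le> x \<longrightarrow> x < alpha (k + 1) \<longrightarrow>
    alpha j \<le> y \<longrightarrow> y < alpha (j + 1) \<longrightarrow> circle_dist (cis x) (cis y) \<le> e \<longrightarrow>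
    circle_dist (f (cis x)) (f (cis y)) \<le> e \<longrightarrow> N dvd j - k)"

text \<open>One point per itinerary. Points of one piece are separated after a step by induction,
  points of different pieces at time 0 or 1; this look ahead is why \<open>n\<close> branch choices
  need \<open>n + 1\<close> times.\<close>

lemma ex_separated:
  assumes e: "separates_pieces e" and "window l r"
  shows "\<exists>E. finite E \<and> E \<subseteq> {l..<r} \<and> card E = laps n l r \<and>
    (\<forall>x\<in>E. \<forall>y\<in>E. x \<noteq> y \<longrightarrow> (\<exists>i<Suc n. circle_dist ((f ^^ i) (cis x)) ((f ^^ i) (cis y)) > e))"
  using assms(2)
proof (induction n arbitrary: l r)
  case 0
  then have "l < r" by (rule window_length)
  then show ?case by (intro exI[of _ "{l}"]) simp
next
  case (Suc n)
  note w = Suc.prems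
  have lt: "l < r" by (rule window_length(3)[OF w])
  obtain j0 where j0: "alpha j0 \<le> l" "r \<le> alpha (j0 + N)"
    using w by (auto simp: window_def)
  let ?l = "\<lambda>k. tau k (max l (alpha k))" and ?r = "\<lambda>k. tau k (min r (alpha (k + 1)))"
  have "\<forall>k\<in>pieces l r. \<exists>E. finite E \<and> E \<subseteq> {?l k..<?r k} \<and> card E = laps n (?l k) (?r k) \<and>
    (\<forall>x\<in>E. \<forall>y\<in>E. x \<noteq> y \<longrightarrow> (\<exists>i<Suc n. circle_dist ((f ^^ i) (cis x)) ((f ^^ i) (cis y)) > e))"
    using Suc.IH window_child[OF lt] by blast
  then obtain E where E: "\<And>k. k \<in> pieces l r \<Longrightarrow> finite (E k) \<and> E k \<subseteq> {?l k..<?r k} \<and>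
    card (E k) = laps n (?l k) (?r k) \<and>
    (\<forall>x\<in>E k. \<forall>y\<in>E k. x \<noteq> y \<longrightarrow> (\<exists>i<Suc n. circle_dist ((f ^^ i) (cis x)) ((f ^^ i) (cis y)) > e))"
    by metis
  define D where "D k = tau_inv k ` E k" for k
  have D: "max l (alpha k) \<le> x" "x < min r (alpha (k + 1))" "tau k x \<in> E k"
    if k: "k \<in> pieces l r" and x: "x \<in> D k" for k x
  proof -
    show y: "tau k x \<in> E k" using x by (auto simp: D_def)
    have "?l k \<le> tau k x" "tau k x < ?r k" using y E[OF k] by auto
    then show "max l (alpha k) \<le> x" "x < min r (alpha (k + 1))" by simp_all
  qed
  have inj: "inj_on (tau_inv k) (E k)" for k
    by (metis inj_onI inv_tau(2))
  have "card (\<Union>k\<in>pieces l r. D k) = (\<Sum>k\<in>pieces l r. card (D k))"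
  proof (rule card_UN_disjoint[OF finite_pieces[OF w]])
    show "\<forall>k\<in>pieces l r. finite (D k)" using E by (simp add: D_def)
    have "D k \<inter> D j = {}" if "k \<in> pieces l r" "j \<in> pieces l r" "k < j" for k j
    proof (rule equals0I)
      fix x assume "x \<in> D k \<inter> D j"
      then have "x < alpha (k + 1)" "alpha j \<le> x" using D that by auto
      then show False using alpha_le[of "k + 1" j] that by linarith
    qed
    then show "\<forall>k\<in>pieces l r. \<forall>j\<in>pieces l r. k \<noteq> j \<longrightarrow> D k \<inter> D j = {}"
      by (metis Int_commute linorder_neqE)
  qed
  also have "\<dots> = laps (Suc n) l r"
    using E inj by (auto simp: D_def card_image intro: sum.cong)
  finally have card: "card (\<Union>k\<in>pieces l r. D k) = laps (Suc n) l r" .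
  show ?case
  proof (intro exI[of _ "\<Union>k\<in>pieces l r. D k"] conjI ballI impI card)
    show "finite (\<Union>k\<in>pieces l r. D k)"
      using E finite_pieces[OF w] by (auto simp: D_def)
    show "(\<Union>k\<in>pieces l r. D k) \<subseteq> {l..<r}"
      using D by fastforce
  next
    fix x y assume "x \<in> (\<Union>k\<in>pieces l r. D k)" "y \<in> (\<Union>k\<in>pieces l r. D k)" and "x \<noteq> y"
    then obtain k j where k: "k \<in> pieces l r" "x \<in> D k" and j: "j \<in> pieces l r" "y \<in> D j"
      by blast
    have kx: "alpha k \<le> x" "x < alpha (k + 1)" and jy: "alpha j \<le> y" "y < alpha (j + 1)"
      using D[OF k] D[OF j] by simp_all
    show "\<exists>i<Suc (Suc n). circle_dist ((f ^^ i) (cis x)) ((f ^^ i) (cis y)) > e"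
    proof (cases "k = j")
      case True
      then have "tau k x \<in> E k" "tau k y \<in> E k" "tau k x \<noteq> tau k y"
        using D[OF k] D[OF j] \<open>x \<noteq> y\<close> inv_tau(1) by metis+
      then obtain i where i: "i < Suc n"
        "circle_dist ((f ^^ i) (cis (tau k x))) ((f ^^ i) (cis (tau k y))) > e"
        using E[OF k(1)] by blast
      then show ?thesis
        using f_cis[OF kx] f_cis[of j y] jy True
        by (intro exI[of _ "Suc i"]) (simp add: funpow_Suc_right del: funpow.simps)
    next
      case False
      have "k \<in> {j0..<j0 + N}" "j \<in> {j0..<j0 + N}"
        using k(1) j(1) pieces_subset[OF j0] by blast+
      then have "\<not> N dvd j - k"
        using False zdvd_not_zless[of "j - k" N] zdvd_not_zless[of "k - j" N]
        by (cases "k < j") (auto simp: dvd_diff_commute)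
      then have "\<not> circle_dist (cis x) (cis y) \<le> e \<or> \<not> circle_dist (f (cis x)) (f (cis y)) \<le> e"
        using e kx jy unfolding separates_pieces_def by blast
      then show ?thesis
        by (auto simp: not_le intro: exI[of _ 0] exI[of _ 1])
    qed
  qed
qed

text \<open>
  Two nearby points on either side of \<open>alpha (k + 1)\<close> are mapped close to
  \<open>[p (s k - 1), p (s k)]\<close> and \<open>[q (s (k + 1) + 1), q (s (k + 1) + 2)]\<close>,
  which lie in nearly opposite parts of the circle.
\<close>

lemma images_far_apart:
  assumes e1: "\<And>k. e < p (k + 1) - q k" and e2: "\<And>k. e < q k - p k"
    and e3: "\<And>k. e < p (k + 1) - tau_inv k (q (s k - 2 + N))"
    and e4: "\<And>k. e < tau_inv k (p (s k + 3)) - q k"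
    and x: "alpha k \<le> x" "x < alpha (k + 1)" and y: "alpha j \<le> y" "y < alpha (j + 1)"
    and xy: "x \<le> y" "y \<le> x + e" and "k \<noteq> j"
  shows "circle_dist (cis (tau k x)) (cis (tau j y)) > e"
proof (rule ccontr)
  assume "\<not> circle_dist (cis (tau k x)) (cis (tau j y)) > e"
  then obtain m :: int where m: "\<bar>tau k x - tau j y - 2 * pi * of_int m\<bar> \<le> e"
    using circle_dist_cis_le_iff by (meson not_le)
  have "\<not> j + 1 \<le> k" using alpha_le[of "j + 1" k] x y xy by linarith
  moreover have "\<not> k + 2 \<le> j"
  proof
    assume "k + 2 \<le> j"
    then have "alpha (k + 2) \<le> y" using alpha_le[of "k + 2" j] y by linarith
    moreover have "e < p (k + 2) - q (k + 1)" using e1[of "k + 1"] by (simp add: add.assoc)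
    ultimately show False
      using x xy p_le_alpha[of "k + 2"] alpha_le_q[of "k + 1"] by linarith
  qed
  ultimately have j: "j = k + 1" using \<open>k \<noteq> j\<close> by linarith
  let ?s = "s (k + 1)"
  \<comment> \<open>The margins \<open>e3\<close> and \<open>e4\<close> let an image stray at most
    one arc \<open>[q i, p (i + 1)]\<close> beyond its limit interval.\<close>
  have "tau_inv k (q (s k - 2 + N)) < x"
    using e3[of k] p_le_alpha[of "k + 1"] x y xy unfolding j by linarith
  then have "tau k (tau_inv k (q (s k - 2 + N))) < tau k x" by (simp only: tau_less_iff)
  moreover have "tau k x < tau k (q (k + 1))"
    using x alpha_le_q[of "k + 1"] by simp
  ultimately have X: "q (s k - 2 + N) < tau k x" "tau k x < p (s k + N)"
    unfolding tau_q_next inv_tau by simp_all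
  have "y < tau_inv (k + 1) (p (?s + 3))"
    using e4[of "k + 1"] alpha_le_q[of "k + 1"] x xy by linarith
  then have "tau j y < tau (k + 1) (tau_inv (k + 1) (p (?s + 3)))" by (simp only: j tau_less_iff)
  moreover have "tau (k + 1) (p (k + 1)) \<le> tau j y"
    using y p_le_alpha[of "k + 1"] unfolding j by simp
  ultimately have Y: "q (?s + 1) \<le> tau j y" "tau j y < p (?s + 3)"
    unfolding tau_p inv_tau by simp_all
  have shift: "p (i + N * m) = p i + 2 * pi * of_int m" "q (i + N * m) = q i + 2 * pi * of_int m" for i m
    using shift_multiple[of p N "2 * pi" i m, OF p_add_N]
      shift_multiple[of q N "2 * pi" i m, OF q_add_N] by simp_all
  \<comment> \<open>By \<open>s_step\<close>, \<open>s k\<close> and \<open>?s\<close> differ by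
    \<open>M + 1\<close> up to full turns; \<open>m'\<close> collects these turns together with
    those of \<open>m\<close>.\<close>
  obtain m' where m': "s k + N - N * m = ?s + M + 1 + N * m'"
  proof (cases "s k = ?s + M + 1")
    case True
    then show thesis by (intro that[of "1 - m"]) (simp add: algebra_simps)
  next
    case False
    then have "s k = ?s + M + 1 - N" using s_step[of k] by simp
    then show thesis by (intro that[of "- m"]) (simp add: algebra_simps)
  qed
  have idx: "?s + M - 1 + N * m' = s k - 2 + N + N * (- m)" "?s + M + 1 + N * m' = s k + N + N * (- m)"
    using m' by simp_all
  have Z: "q (?s + M - 1 + N * m') < tau k x - 2 * pi * of_int m"
    "tau k x - 2 * pi * of_int m < p (?s + M + 1 + N * m')"
    using X unfolding idx shift by simp_all
  \<comment> \<open>The image of \<open>x\<close> lies beyond \<open>q (?s + 3)\<close> or before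
    \<open>p (?s + 1)\<close>; either way an arc \<open>[p i, q i]\<close> longer than
    \<open>e\<close> lies between the two images.\<close>
  show False
  proof (cases "m' \<ge> 0")
    case True
    then have "?s + 3 \<le> ?s + M - 1 + N * m'"
      using M_ge N_pos by (simp add: add_increasing2)
    then have "q (?s + 3) \<le> q (?s + M - 1 + N * m')" by (rule q_le)
    then show False using Z Y m e2[of "?s + 3"] by linarith
  next
    case False
    then have "N * m' \<le> N * (- 1)" using N_pos by (intro mult_left_mono) simp_all
    then have "?s + M + 1 + N * m' \<le> ?s + 1" using M_ge N_eq by simp
    then have "p (?s + M + 1 + N * m') \<le> p (?s + 1)" by (rule p_le)
    then show False using Z Y m e2[of "?s + 1"] by linarith
  qed
qed

text \<open>The four margins needed at a cut are positive and periodic in \<open>k\<close>, so one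
  bound serves all cuts.\<close>

lemma ex_separates_pieces:
  obtains e0 where "e0 > 0" "\<And>e. e \<le> e0 \<Longrightarrow> separates_pieces e"
proof -
  define u where "u k = tau_inv k (q (s k - 2 + N))" for k
  define v where "v k = tau_inv k (p (s k + 3))" for k
  have tau_u: "tau k (u k) = q (s k - 2 + N)" and tau_v: "tau k (v k) = p (s k + 3)" for k
    by (simp_all add: u_def v_def)
  have u: "u k < p (k + 1)" for k
  proof -
    have "s k - 1 + N = s k - 2 + N + 1" by simp
    then have "tau k (u k) < tau k (p (k + 1))"
      unfolding tau_u tau_p_next by (simp only: q_less_p)
    then show ?thesis by simp
  qed
  have v: "q k < v k" for k
  proof -
    have "s k + 3 = s k + 2 + 1" by simp
    then have "tau k (q k) < tau k (v k)"
      unfolding tau_v tau_q by (simp only: q_less_p)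
    then show ?thesis by simp
  qed
  have u_shift: "u (k + N) = u k + 2 * pi" for k
  proof -
    have "tau (k + N) (u k + 2 * pi) = tau (k + N) (u (k + N))"
      unfolding tau_add_N tau_u s_add_N using q_add_N[of "s k - 2"] by simp
    then show ?thesis by (metis inv_tau(1))
  qed
  have v_shift: "v (k + N) = v k + 2 * pi" for k
  proof -
    have "tau (k + N) (v k + 2 * pi) = tau (k + N) (v (k + N))"
      unfolding tau_add_N tau_v s_add_N using p_add_N[of "s k - N + 3"] by (simp add: algebra_simps)
    then show ?thesis by (metis inv_tau(1))
  qed
  define F where "F k = Min {p (k + 1) - q k, q k - p k, p (k + 1) - u k, v k - q k}" for k
  have F_shift: "F (k + N) = F k" for k
  proof -
    have "p (k + N + 1) = p (k + 1) + 2 * pi"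
      using p_add_N[of "k + 1"] by (simp add: algebra_simps)
    then show ?thesis by (simp add: F_def p_add_N q_add_N u_shift v_shift)
  qed
  have F_pos: "F k > 0" for k
    using p_less_q[of k] q_less_p[of k] u[of k] v[of k] by (simp add: F_def)
  obtain e0 where e0: "e0 > 0" "\<And>k. e0 < F k"
    using periodic_pos_lower_bound[of N F] F_shift F_pos N_pos by blast
  show thesis
  proof (rule that[OF e0(1)])
    fix e assume "e \<le> e0"
    then have eF: "e < F k" for k using e0(2)[of k] by simp
    have far: "circle_dist (cis (tau k x)) (cis (tau j y)) > e"
      if "alpha k \<le> x" "x < alpha (k + 1)" "alpha j \<le> y" "y < alpha (j + 1)"
        "x \<le> y" "y \<le> x + e" "k \<noteq> j" for x y k j
      by (rule images_far_apart[OF _ _ _ _ that]) (use eF in \<open>simp_all add: F_def u_def v_def\<close>)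
    show "separates_pieces e"
      unfolding separates_pieces_def
    proof (intro allI impI)
      fix x y k j
      assume x: "alpha k \<le> x" "x < alpha (k + 1)" and y: "alpha j \<le> y" "y < alpha (j + 1)"
        and d: "circle_dist (cis x) (cis y) \<le> e" "circle_dist (f (cis x)) (f (cis y)) \<le> e"
      obtain m :: int where m: "\<bar>x - y - 2 * pi * of_int m\<bar> \<le> e"
        using d(1) circle_dist_cis_le_iff by blast
      define y' where "y' = y + 2 * pi * of_int m"
      define j' where "j' = j + N * m"
      have shift: "alpha (i + N * m) = alpha i + 2 * pi * of_int m" for i m
        using shift_multiple[of alpha N "2 * pi" i m, OF alpha_add_N] by simp
      have y': "alpha j' \<le> y'" "y' < alpha (j' + 1)"
        using y shift[of j m] shift[of "j + 1" m] by (simp_all add: y'_def j'_def algebra_simps)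
      have "cis y' = cis y" using cis_eq_cis_iff y'_def by blast
      then have "circle_dist (cis (tau k x)) (cis (tau j' y')) \<le> e"
        using d(2) f_cis[OF x] f_cis[OF y'] by simp
      moreover have "\<bar>x - y'\<bar> \<le> e" using m by (simp add: y'_def algebra_simps)
      ultimately have "k = j'"
        using far[OF x y'] far[OF y' x] circle_dist_cis_commute[of "tau k x" "tau j' y'"]
        by (cases "x \<le> y'") force+
      then show "N dvd j - k" by (simp add: j'_def)
    qed
  qed
qed

end

section \<open>Entropy of the lifted dynamics\<close>

text \<open>The shift by one step and the linear factor both disappear in the limit of
  \<open>ln (m n) / n\<close>, so the two bounds squeeze it.\<close>

lemma limsup_growth_rate:
  fixes s :: "nat \<Rightarrow> enat"
  assumes lam: "lam > 1" and e: "e > 0" and C: "C > 0"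
    and lower: "\<And>n. ereal (lam ^ n) \<le> ereal_of_enat (s (Suc n))"
    and upper: "\<And>n. ereal_of_enat (s n) \<le> ereal (C * lam ^ n * (2 * pi * real n / e + 1))"
  shows "limsup (\<lambda>n. ln_enat (s n) / ereal (real n)) = ereal (ln lam)"
proof -
  have "\<exists>m. s n = enat m" for n
    using upper[of n] by (cases "s n") auto
  then obtain m where m: "\<And>n. s n = enat (m n)" by metis
  have lo: "lam ^ n \<le> real (m (Suc n))" for n using lower[of n] by (simp add: m)
  have hi: "real (m n) \<le> C * lam ^ n * (2 * pi * real n / e + 1)" for n
    using upper[of n] by (simp add: m)
  have "(\<lambda>n. ln (real (m n)) / real n) \<longlonglongrightarrow> ln lam"
  proof (rule tendsto_sandwich)
    show "\<forall>\<^sub>F n in sequentially. (real n - 1) * ln lam / real n \<le> ln (real (m n)) / real n"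
      using eventually_gt_at_top[of 0]
    proof eventually_elim
      case (elim n)
      then obtain k where k: "n = Suc k" by (cases n) auto
      have "0 < lam ^ k" using lam by simp
      then have "ln (lam ^ k) \<le> ln (real (m n))"
        using lo[of k, folded k] by (subst ln_le_cancel_iff) linarith+
      then have "(real n - 1) * ln lam \<le> ln (real (m n))"
        using lam by (simp add: k ln_realpow)
      then show ?case by (intro divide_right_mono) simp_all
    qed
    show "\<forall>\<^sub>F n in sequentially. ln (real (m n)) / real n \<le>
        (ln C + real n * ln lam + ln (2 * pi * real n / e + 1)) / real n"
      using eventually_gt_at_top[of 0]
    proof eventually_elim
      case (elim n)
      then obtain k where k: "n = Suc k" by (cases n) auto
      have pos: "2 * pi * real n / e + 1 > 0" using e by (intro add_nonneg_pos) simp_all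
      have "0 < lam ^ k" using lam by simp
      then have "0 < real (m n)" using lo[of k] k by simp
      then have "ln (real (m n)) \<le> ln (C * lam ^ n * (2 * pi * real n / e + 1))"
        using hi[of n] by (subst ln_le_cancel_iff) linarith+
      also have "\<dots> = ln C + real n * ln lam + ln (2 * pi * real n / e + 1)"
        using C lam pos by (simp add: ln_mult ln_realpow)
      finally show ?case by (intro divide_right_mono) simp_all
    qed
    show "(\<lambda>n. (real n - 1) * ln lam / real n) \<longlonglongrightarrow> ln lam" by real_asymp
    show "(\<lambda>n. (ln C + real n * ln lam + ln (2 * pi * real n / e + 1)) / real n) \<longlonglongrightarrow> ln lam"
      using e by real_asymp
  qed
  then have "(\<lambda>n. ereal (ln (real (m n)) / real n)) \<longlonglongrightarrow> ereal (ln lam)"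
    by (simp add: lim_ereal)
  moreover have "\<forall>\<^sub>F n in sequentially.
      ereal (ln (real (m n)) / real n) = ln_enat (s n) / ereal (real n)"
    using eventually_gt_at_top[of 0] by eventually_elim (simp add: m ln_enat_def)
  ultimately have "(\<lambda>n. ln_enat (s n) / ereal (real n)) \<longlonglongrightarrow> ereal (ln lam)"
    by (rule Lim_transform_eventually)
  then show ?thesis by (intro lim_imp_Limsup) simp_all
qed

context boundary_dynamics
begin

lemma window_circle: "window (alpha 0) (alpha N)"
  unfolding window_def using N_pos alpha_less[of 0 N] by (auto intro: exI[of _ 0])

lemma phi_circle: "phi (alpha N) - phi (alpha 0) = lam * of_int N"
  using alpha_add_N[of 0] phi_shift[of "alpha 0"] by simp

lemma cis_inj_on: "inj_on cis {alpha 0..<alpha N}"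
proof (rule inj_onI)
  fix x y assume "x \<in> {alpha 0..<alpha N}" "y \<in> {alpha 0..<alpha N}" "cis x = cis y"
  then show "x = y"
    using alpha_add_N[of 0] by (intro cis_eq_in_window[of x y "alpha 0"]) simp_all
qed

text \<open>Comes from \<open>laps_le\<close> on a full turn, of mass \<open>lam * N\<close>, after
  bounding the leading \<open>2 ^ n\<close> by \<open>lam ^ n\<close>.\<close>

definition growth_const :: real
  where "growth_const = 1 + lam * of_int N / ((lam - 1) * (lam - 2))"

lemma growth_const_pos: "growth_const > 0"
  unfolding growth_const_def using lam_gt N_pos by (intro add_pos_nonneg) simp_all

lemma laps_circle_le: "real (laps n (alpha 0) (alpha N)) \<le> growth_const * lam ^ n"
proof -
  have *: "real (laps n (alpha 0) (alpha N)) \<le>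
      2 ^ n + (lam ^ n - 2 ^ n) / ((lam - 1) * (lam - 2)) * (lam * of_int N)"
    using laps_le[OF window_circle, of n] by (simp add: phi_circle)
  have "(lam ^ n - 2 ^ n) / ((lam - 1) * (lam - 2)) * (lam * of_int N) \<le>
      lam ^ n / ((lam - 1) * (lam - 2)) * (lam * of_int N)"
    using lam_gt N_pos by (intro mult_right_mono divide_right_mono) simp_all
  moreover have "2 ^ n \<le> lam ^ n" using lam_gt by (intro power_mono) simp_all
  ultimately show ?thesis using * by (simp add: growth_const_def algebra_simps)
qed

lemma max_separated_le:
  assumes "e > 0"
  shows "ereal_of_enat (max_separated (sphere 0 1) circle_dist f n e) \<le>
    ereal (growth_const * lam ^ n * (2 * pi * real n / e + 1))"
proof -
  let ?c = "growth_const * lam ^ n * (2 * pi * real n / e + 1)"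
  have c: "?c \<ge> 0" using growth_const_pos lam_gt assms by (intro mult_nonneg_nonneg) simp_all
  have "enat (card E) \<le> enat (nat \<lfloor>?c\<rfloor>)"
    if fin: "finite E" and sep: "separated_set (sphere 0 1) circle_dist f n e E" for E
  proof -
    have E: "E \<subseteq> sphere 0 1" and
      sep': "\<And>x y. x \<in> E \<Longrightarrow> y \<in> E \<Longrightarrow> x \<noteq> y \<Longrightarrow> \<exists>i<n. circle_dist ((f ^^ i) x) ((f ^^ i) y) > e"
      using sep unfolding separated_set_def by blast+
    have "sphere 0 1 \<subseteq> cis ` {alpha 0..<alpha N}"
    proof
      fix z :: complex assume "z \<in> sphere 0 1"
      then obtain t where "alpha 0 \<le> t" "t < alpha 0 + 2 * pi" "z = cis t"
        by (rule sphere_eq_cis)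
      then show "z \<in> cis ` {alpha 0..<alpha N}" using alpha_add_N[of 0] by simp
    qed
    then obtain D where D: "D \<subseteq> {alpha 0..<alpha N}" "E = cis ` D"
      using E by (meson order_trans subset_imageE)
    have inj: "inj_on cis D" using cis_inj_on D inj_on_subset by blast
    then have "finite D" and card: "card E = card D"
      using fin D finite_image_iff card_image by blast+
    \<comment> \<open>Before the first step nothing has been accumulated: \<open>h = 0\<close> with
      range \<open>B = 0\<close>.\<close>
    have "real (card D) \<le>
        real (laps n (alpha 0) (alpha N)) * ((0 + 2 * pi * real n) / e + 1)"
    proof (rule card_separated_le[OF window_circle \<open>finite D\<close> D(1) assms, where h = "\<lambda>_. 0" and c = 0])
      fix x y assume "x \<in> D" "y \<in> D" "x < y"
      then have "cis x \<noteq> cis y" using inj by (auto dest: inj_onD)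
      then show "0 - 0 > e \<or> (\<exists>i<n. circle_dist ((f ^^ i) (cis x)) ((f ^^ i) (cis y)) > e)"
        using sep' D \<open>x \<in> D\<close> \<open>y \<in> D\<close> by blast
    qed simp_all
    also have "\<dots> \<le> ?c"
      using assms by (simp add: mult_right_mono[OF laps_circle_le])
    finally have "real (card E) \<le> ?c" using card by simp
    then show ?thesis by (simp add: le_nat_floor)
  qed
  then have "max_separated (sphere 0 1) circle_dist f n e \<le> enat (nat \<lfloor>?c\<rfloor>)"
    unfolding max_separated_def by (intro SUP_least) blast
  then have "ereal_of_enat (max_separated (sphere 0 1) circle_dist f n e) \<le> ereal (real (nat \<lfloor>?c\<rfloor>))"
    using ereal_of_enat_le_iff[of _ "enat (nat \<lfloor>?c\<rfloor>)"] by simp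
  also have "\<dots> \<le> ereal ?c" using of_nat_floor[OF c] by simp
  finally show ?thesis .
qed

lemma max_separated_ge:
  assumes "separates_pieces e"
  shows "ereal (lam ^ n) \<le> ereal_of_enat (max_separated (sphere 0 1) circle_dist f (Suc n) e)"
proof -
  obtain D where D: "finite D" "D \<subseteq> {alpha 0..<alpha N}" "card D = laps n (alpha 0) (alpha N)"
    and sep: "\<And>x y. x \<in> D \<Longrightarrow> y \<in> D \<Longrightarrow> x \<noteq> y \<Longrightarrow>
      \<exists>i<Suc n. circle_dist ((f ^^ i) (cis x)) ((f ^^ i) (cis y)) > e"
    using ex_separated[OF assms window_circle, of n] by blast
  have "inj_on cis D" using cis_inj_on D inj_on_subset by blast
  then have "card (cis ` D) = laps n (alpha 0) (alpha N)" using D by (simp add: card_image)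
  moreover have "separated_set (sphere 0 1) circle_dist f (Suc n) e (cis ` D)"
    unfolding separated_set_def using sep by fastforce
  then have "enat (card (cis ` D)) \<le> max_separated (sphere 0 1) circle_dist f (Suc n) e"
    unfolding max_separated_def using D by (intro SUP_upper) simp
  moreover have "lam ^ n \<le> real (laps n (alpha 0) (alpha N))"
  proof -
    have "lam * of_int N * lam ^ n \<le> lam * of_int N * real (laps n (alpha 0) (alpha N))"
      using laps_ge[OF window_circle, of n] by (simp add: phi_circle mult.commute)
    then show ?thesis using lam_gt N_pos by simp
  qed
  ultimately show ?thesis
    by (metis ereal_less_eq(3) ereal_of_enat_le_iff ereal_of_enat_simps(1) order_trans)
qed

text \<open>The inner \<open>limsup\<close> is already constant for small \<open>e\<close>, so the
  outer limit is trivial.\<close>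

lemma entropy_eq: "topological_entropy (sphere 0 1) circle_dist f = ereal (ln lam)"
proof -
  let ?h = "\<lambda>e. limsup (\<lambda>n. ln_enat (max_separated (sphere 0 1) circle_dist f n e) / ereal (real n))"
  obtain e0 where e0: "e0 > 0" "\<And>e. e \<le> e0 \<Longrightarrow> separates_pieces e"
    using ex_separates_pieces by blast
  have "\<forall>\<^sub>F e in at_right 0. e \<in> {0<..<e0}"
    using e0(1) by (intro eventually_at_right_real)
  then have "\<forall>\<^sub>F e in at_right 0. ereal (ln lam) = ?h e"
  proof eventually_elim
    case (elim e)
    then show ?case
      using lam_gt growth_const_pos e0(2)[of e]
      by (intro limsup_growth_rate[symmetric, of _ e growth_const] max_separated_ge max_separated_le)
        simp_all
  qed
  then have "(?h \<longlongrightarrow> ereal (ln lam)) (at_right 0)"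
    by (rule Lim_transform_eventually[OF tendsto_const])
  then show ?thesis
    unfolding topological_entropy_def by (intro tendsto_Lim) simp_all
qed

end

section \<open>Geodesics and lifts of disc isometries\<close>

lemma cmod_eq_1_mult_cnj: "cmod z = 1 \<Longrightarrow> z * cnj z = 1"
  by (metis complex_norm_square of_real_1 one_power2)

lemma one_minus_cnj_mult_nz:
  assumes "cmod w < 1" "cmod z \<le> 1"
  shows "1 - cnj w * z \<noteq> 0"
proof
  assume "1 - cnj w * z = 0"
  then have "cmod (cnj w * z) = 1" by (metis eq_iff_diff_eq_0 norm_one)
  then have "cmod w * cmod z = 1" by (simp add: norm_mult)
  moreover have "cmod w * cmod z \<le> cmod w * 1"
    using assms by (intro mult_left_mono) simp_all
  ultimately show False using assms by simp
qed

lemma Moebius_inverse: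
  assumes "cmod x < 1" "cmod z \<le> 1"
  shows "Moebius_function 0 (- x) (Moebius_function 0 x z) = z"
    and "Moebius_function 0 x (Moebius_function 0 (- x) z) = z"
proof -
  have nz: "1 - cnj x * z \<noteq> 0" "1 + cnj x * z \<noteq> 0" "1 - cnj x * x \<noteq> 0"
    using one_minus_cnj_mult_nz[of x z] one_minus_cnj_mult_nz[of x x]
      one_minus_cnj_mult_nz[of x "- z"] assms by simp_all
  have "1 + cnj x * ((z - x) / (1 - cnj x * z)) = (1 - cnj x * x) / (1 - cnj x * z)"
    "(z - x) / (1 - cnj x * z) + x = z * (1 - cnj x * x) / (1 - cnj x * z)"
    using nz(1) by (simp_all add: field_simps)
  then show "Moebius_function 0 (- x) (Moebius_function 0 x z) = z"
    using nz by (simp add: Moebius_function_simple)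
  have "1 - cnj x * ((z + x) / (1 + cnj x * z)) = (1 - cnj x * x) / (1 + cnj x * z)"
    "(z + x) / (1 + cnj x * z) - x = z * (1 - cnj x * x) / (1 + cnj x * z)"
    using nz(2) by (simp_all add: field_simps)
  then show "Moebius_function 0 x (Moebius_function 0 (- x) z) = z"
    using nz by (simp add: Moebius_function_simple)
qed

lemma norm_Moebius_eq_1:
  assumes "cmod w < 1" "cmod z = 1"
  shows "cmod (Moebius_function t w z) = 1"
proof -
  have "z - w = z * cnj (1 - cnj w * z)"
    using cmod_eq_1_mult_cnj[OF assms(2)] by (simp add: algebra_simps)
  then have "cmod (z - w) = cmod (1 - cnj w * z)"
    using assms by (metis complex_mod_cnj mult_cancel_right1 norm_mult)
  then show ?thesis
    using one_minus_cnj_mult_nz[of w z] assms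
    by (simp add: Moebius_function_def norm_mult norm_divide)
qed

text \<open>Both sides are disc automorphisms that send \<open>x\<close> to \<open>0\<close>, so
  they differ by a rotation. The witness \<open>?u\<close> is the direction of the derivative of
  \<open>Moebius_function t w\<close> at \<open>x\<close>.\<close>

lemma Moebius_conjugate:
  assumes w: "cmod w < 1" and x: "cmod x < 1"
  obtains u where "cmod u = 1" "\<And>z. cmod z \<le> 1 \<Longrightarrow>
    Moebius_function 0 (Moebius_function t w x) (Moebius_function t w z) = u * Moebius_function 0 x z"
proof
  let ?e = "exp (\<i> * of_real t)"
  let ?u = "?e * cnj (1 - cnj w * x) / (1 - cnj w * x)"
  have nx: "1 - cnj w * x \<noteq> 0" using one_minus_cnj_mult_nz[of w x] w x by simp
  show "cmod ?u = 1"
    using nx by (simp add: norm_mult norm_divide) (metis complex_cnj_cnj complex_cnj_diff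
        complex_cnj_mult complex_cnj_one complex_mod_cnj divide_self_if norm_eq_zero)
  fix z assume z: "cmod z \<le> 1"
  have nz: "1 - cnj w * z \<noteq> 0" and nw: "1 - cnj w * w \<noteq> 0" and nxz: "1 - cnj x * z \<noteq> 0"
    and nx': "1 - w * cnj x \<noteq> 0"
    using one_minus_cnj_mult_nz[of w z] one_minus_cnj_mult_nz[of w w] one_minus_cnj_mult_nz[of x z]
      one_minus_cnj_mult_nz[of x w] w x z by (simp_all add: mult.commute)
  have e: "cnj ?e * ?e = 1"
    using cmod_eq_1_mult_cnj[of ?e] by (simp add: mult.commute)
  have 1: "Moebius_function t w z - Moebius_function t w x =
      ?e * ((z - x) * (1 - cnj w * w) / ((1 - cnj w * z) * (1 - cnj w * x)))"
    using nx nz by (simp add: Moebius_function_def divide_simps) (simp add: algebra_simps)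
  have "cnj (Moebius_function t w x) * Moebius_function t w z =
      (cnj ?e * ?e) * ((cnj x - cnj w) * (z - w) / ((1 - w * cnj x) * (1 - cnj w * z)))"
    by (simp add: Moebius_function_def)
  then have 2: "1 - cnj (Moebius_function t w x) * Moebius_function t w z =
      (1 - cnj w * w) * (1 - cnj x * z) / ((1 - w * cnj x) * (1 - cnj w * z))"
    unfolding e using nx' nz by (simp add: divide_simps) (simp add: algebra_simps)
  show "Moebius_function 0 (Moebius_function t w x) (Moebius_function t w z) =
      ?u * Moebius_function 0 x z"
    unfolding Moebius_function_simple[of "Moebius_function t w x"] 1 2
    using nx nz nw nxz nx' by (simp add: Moebius_function_simple divide_simps)
qed

lemma Moebius_eq_0_iff:
  assumes "cmod x < 1" "cmod y < 1"
  shows "Moebius_function 0 x y = 0 \<longleftrightarrow> y = x"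
  using one_minus_cnj_mult_nz[of x y] assms by (auto simp: Moebius_function_simple)

lemma norm_sgn_Moebius:
  assumes "cmod x < 1" "cmod y < 1" "x \<noteq> y"
  shows "cmod (sgn (Moebius_function 0 x y)) = 1"
  using assms by (simp add: norm_sgn Moebius_eq_0_iff)

lemma Moebius_geo_end:
  assumes "cmod x < 1" "cmod y < 1" "x \<noteq> y"
  shows "Moebius_function 0 x (geo_end x y) = sgn (Moebius_function 0 x y)"
    and "cmod (geo_end x y) = 1"
    and "Moebius_function 0 x (geo_start x y) = - sgn (Moebius_function 0 x y)"
    and "cmod (geo_start x y) = 1"
  using norm_sgn_Moebius[OF assms] assms
  by (simp_all add: geo_end_def geo_start_def Moebius_inverse norm_Moebius_eq_1)

lemma geo_endI:
  assumes "cmod x < 1" "cmod z \<le> 1" "Moebius_function 0 x z = sgn (Moebius_function 0 x y)"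
  shows "z = geo_end x y"
  using Moebius_inverse(1)[OF assms(1,2)] by (simp add: geo_end_def assms(3))

lemma geo_startI:
  assumes "cmod x < 1" "cmod z \<le> 1" "Moebius_function 0 x z = - sgn (Moebius_function 0 x y)"
  shows "z = geo_start x y"
  using Moebius_inverse(1)[OF assms(1,2)] by (simp add: geo_start_def assms(3))

text \<open>Seen from \<open>x\<close>, everything lies on one diameter: \<open>x\<close>,
  \<open>y\<close> and the endpoint become \<open>0\<close>, \<open>r * d\<close> and
  \<open>d\<close>, and moving \<open>r * d\<close> to the centre fixes \<open>d\<close>.\<close>

lemma geo_start_swap:
  assumes x: "cmod x < 1" and y: "cmod y < 1" and "x \<noteq> y"
  shows "geo_start y x = geo_end x y"
proof -
  let ?M = "Moebius_function 0 x"
  define d where "d = sgn (?M y)"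
  define r where "r = cmod (?M y)"
  have d: "d * cnj d = 1" "cmod d = 1"
    using norm_sgn_Moebius[OF assms] cmod_eq_1_mult_cnj by (simp_all add: d_def)
  have r: "0 < r" "r < 1"
    using Moebius_function_norm_lt_1[OF x y] Moebius_eq_0_iff[OF x y] \<open>x \<noteq> y\<close>
    by (simp_all add: r_def)
  have My: "?M y = of_real r * d"
    using r by (simp add: d_def r_def sgn_eq)
  obtain u where u: "cmod u = 1" "\<And>z. cmod z \<le> 1 \<Longrightarrow>
      Moebius_function 0 (?M y) (?M z) = u * Moebius_function 0 y z"
    using Moebius_conjugate[OF x y] by blast
  have "u * Moebius_function 0 y (geo_end x y) = Moebius_function 0 (?M y) (?M (geo_end x y))"
    using u(2)[of "geo_end x y"] Moebius_geo_end[OF assms] by simp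
  also have "?M (geo_end x y) = d"
    using Moebius_geo_end[OF assms] by (simp add: d_def)
  also have "Moebius_function 0 (?M y) d = (d - of_real r * d) / (1 - of_real r * (d * cnj d))"
    unfolding My by (simp add: Moebius_function_simple mult.commute mult.left_commute)
  also have "\<dots> = d"
  proof -
    have "1 - complex_of_real r \<noteq> 0" using r by (metis eq_iff_diff_eq_0 less_irrefl of_real_eq_1_iff)
    then show ?thesis unfolding d(1) by (simp add: divide_simps) (simp add: algebra_simps)
  qed
  finally have 1: "u * Moebius_function 0 y (geo_end x y) = d" .
  have "?M x = 0" by (simp add: Moebius_function_eq_zero)
  then have "u * Moebius_function 0 y x = - of_real r * d"
    using u(2)[of x] x unfolding My by (simp add: Moebius_function_simple)
  then have "sgn (u * Moebius_function 0 y x) = - d"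
    using r d by (simp add: sgn_mult sgn_of_real) (simp add: sgn_eq)
  then have "u * sgn (Moebius_function 0 y x) = - d"
    using u(1) by (simp add: sgn_mult) (simp add: sgn_eq)
  then have "u * Moebius_function 0 y (geo_end x y) = u * (- sgn (Moebius_function 0 y x))"
    using 1 by (simp add: minus_equation_iff)
  then have "Moebius_function 0 y (geo_end x y) = - sgn (Moebius_function 0 y x)"
    using u(1) by (metis mult_left_cancel norm_zero zero_neq_one)
  then have "geo_end x y = geo_start y x"
    using Moebius_geo_end[OF assms] by (intro geo_startI[OF y]) simp_all
  then show ?thesis ..
qed

lemma sgn_angle:
  assumes "cmod x < 1" "cmod y < 1" "cmod z < 1" "x \<noteq> y" "x \<noteq> z"
  shows "sgn (Moebius_function 0 x z) = cis (geo_angle x y z) * sgn (Moebius_function 0 x y)"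
proof -
  let ?y = "Moebius_function 0 x y" and ?z = "Moebius_function 0 x z"
  have nz: "?y \<noteq> 0" "?z \<noteq> 0" using assms by (simp_all add: Moebius_eq_0_iff)
  have "?z / ?y = of_real (cmod (?z / ?y)) * cis (geo_angle x y z)"
    using Arg2pi_eq[of "?z / ?y"] unfolding geo_angle_def cis_conv_exp by simp
  then have "sgn (?z / ?y) = sgn (of_real (cmod (?z / ?y)) * cis (geo_angle x y z))" by simp
  also have "\<dots> = cis (geo_angle x y z)"
    using nz by (simp add: sgn_mult sgn_of_real sgn_cis)
  finally have "sgn ?z / sgn ?y = cis (geo_angle x y z)"
    by (simp add: sgn_divide)
  moreover have "sgn ?y \<noteq> 0" using nz by (simp add: sgn_zero_iff)
  ultimately show ?thesis by (simp add: divide_eq_eq)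
qed

lemma disc_isometryD:
  assumes "F \<in> disc_isometries"
  shows "\<exists>t w. cmod w < 1 \<and> (\<forall>z. cmod z \<le> 1 \<longrightarrow> F z = Moebius_function t w z)"
proof -
  obtain t w where "cmod w < 1" "F = restrict (Moebius_function t w) (cball 0 1)"
    using assms unfolding disc_isometries_def by blast
  then show ?thesis by (intro exI[of _ t] exI[of _ w]) simp
qed

lemma disc_isometry_norm:
  assumes "F \<in> disc_isometries"
  shows "cmod z < 1 \<Longrightarrow> cmod (F z) < 1" "cmod z = 1 \<Longrightarrow> cmod (F z) = 1"
  using disc_isometryD[OF assms] Moebius_function_norm_lt_1 norm_Moebius_eq_1
  by (metis less_imp_le order_refl)+

lemma disc_isometry_conjugate:
  assumes "F \<in> disc_isometries" "cmod x < 1"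
  obtains u where "cmod u = 1"
    "\<And>z. cmod z \<le> 1 \<Longrightarrow> Moebius_function 0 (F x) (F z) = u * Moebius_function 0 x z"
proof -
  obtain t w where w: "cmod w < 1" and F: "\<And>z. cmod z \<le> 1 \<Longrightarrow> F z = Moebius_function t w z"
    using disc_isometryD[OF assms(1)] by blast
  obtain u where "cmod u = 1" "\<And>z. cmod z \<le> 1 \<Longrightarrow>
      Moebius_function 0 (Moebius_function t w x) (Moebius_function t w z) = u * Moebius_function 0 x z"
    using Moebius_conjugate[OF w assms(2)] by blast
  then show thesis using that[of u] assms(2) by (simp add: F)
qed

lemma sgn_rotate: "cmod u = 1 \<Longrightarrow> sgn (u * z) = u * sgn (z :: complex)"
  by (simp add: sgn_mult) (simp add: sgn_eq)

lemma disc_isometry_geo_end: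
  assumes F: "F \<in> disc_isometries" and x: "cmod x < 1" and y: "cmod y < 1" and "x \<noteq> y"
  shows "F (geo_end x y) = geo_end (F x) (F y)" "F (geo_start x y) = geo_start (F x) (F y)"
proof -
  obtain u where u: "cmod u = 1"
    "\<And>z. cmod z \<le> 1 \<Longrightarrow> Moebius_function 0 (F x) (F z) = u * Moebius_function 0 x z"
    using disc_isometry_conjugate[OF F x] by blast
  note ends = Moebius_geo_end[OF x y \<open>x \<noteq> y\<close>]
  have "sgn (Moebius_function 0 (F x) (F y)) = u * sgn (Moebius_function 0 x y)"
    using u(2)[of y] y sgn_rotate[OF u(1)] by simp
  then show "F (geo_end x y) = geo_end (F x) (F y)" "F (geo_start x y) = geo_start (F x) (F y)"
    using u(2)[of "geo_end x y"] u(2)[of "geo_start x y"] ends disc_isometry_norm[OF F] x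
    by (auto intro!: geo_endI geo_startI)
qed

lemma disc_isometry_sgn:
  assumes F: "F \<in> disc_isometries" and x: "cmod x < 1"
  obtains u where "cmod u = 1"
    "\<And>z. cmod z \<le> 1 \<Longrightarrow> Moebius_function 0 (F x) (F z) = u * Moebius_function 0 x z"
    "\<And>z. cmod z \<le> 1 \<Longrightarrow> sgn (Moebius_function 0 (F x) (F z)) = u * sgn (Moebius_function 0 x z)"
proof -
  obtain u where "cmod u = 1"
    "\<And>z. cmod z \<le> 1 \<Longrightarrow> Moebius_function 0 (F x) (F z) = u * Moebius_function 0 x z"
    using disc_isometry_conjugate[OF F x] by blast
  then show thesis using that[of u] sgn_rotate by simp
qed

section \<open>Lifts of isometries to the line\<close>

text \<open>With \<open>z = 1 - w * cis (- t)\<close>, the image of \<open>cis t\<close> is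
  \<open>cis th * cis t * z / cnj z\<close>, and \<open>z / cnj z\<close> has angle
  \<open>2 * Arg z\<close>. Since \<open>cmod w < 1\<close>, \<open>z\<close> stays in the right
  half plane, where \<open>Arg\<close> has no jump.\<close>

lemma Moebius_circle_lift:
  fixes th :: real
  assumes w: "cmod w < 1"
  defines "L \<equiv> \<lambda>t. th + t + 2 * Arg (1 - w * cis (- t))"
  shows "cis (L t) = Moebius_function th w (cis t)" "L (t + 2 * pi) = L t + 2 * pi"
    "continuous_on UNIV L"
proof -
  have nz: "1 - cnj w * cis t \<noteq> 0" "1 - w * cis (- t) \<noteq> 0" for t
    using one_minus_cnj_mult_nz[of w "cis t"] one_minus_cnj_mult_nz[of "cnj w" "cis (- t)"] w by simp_all
  define z where "z = 1 - w * cis (- t)"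
  have z: "z \<noteq> 0" "cnj z = 1 - cnj w * cis t" using nz(2)[of t] by (simp_all add: z_def cis_cnj)
  have "cis (2 * Arg z) = cis (Arg z) * cis (Arg z)" unfolding cis_mult by simp
  also have "\<dots> = sgn z * sgn z" using z by (simp add: cis_Arg)
  also have "\<dots> = z / cnj z"
  proof -
    have "z * cnj z = of_real (cmod z) * of_real (cmod z)"
      using complex_norm_square[of z] by (simp add: power2_eq_square)
    then show ?thesis using z(1) by (simp add: sgn_eq divide_simps mult_ac)
  qed
  finally have "cis (2 * Arg z) = z / cnj z" .
  then have "cis (L t) = cis th * ((cis t * z) / cnj z)"
    unfolding L_def z_def[symmetric] cis_mult[symmetric] by simp
  also have "cis t * z = cis t - w" by (simp add: z_def right_diff_distrib mult.left_commute cis_mult)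
  finally show "cis (L t) = Moebius_function th w (cis t)"
    unfolding z(2) by (simp add: Moebius_function_def cis_conv_exp mult.commute)
  have "cis (- t - 2 * pi) = cis (- t)" for t
    using cis_eq_cis_iff[of "- t - 2 * pi" "- t"] by (auto intro: exI[of _ "-1"])
  then show "L (t + 2 * pi) = L t + 2 * pi" by (simp add: L_def)
  have "1 - w * cis (- t) \<notin> \<real>\<^sub>\<le>\<^sub>0" for t
  proof
    assume "1 - w * cis (- t) \<in> \<real>\<^sub>\<le>\<^sub>0"
    then have "Re (w * cis (- t)) \<ge> 1" by (simp add: complex_nonpos_Reals_iff)
    moreover have "Re (w * cis (- t)) \<le> cmod (w * cis (- t))" by (rule complex_Re_le_cmod)
    ultimately show False using w by (simp add: norm_mult)
  qed
  then have "isCont Arg (1 - w * cis (- t))" for t by (rule continuous_at_Arg)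
  moreover have "isCont (\<lambda>t. 1 - w * cis (- t)) t" for t
    unfolding cis_conv_exp by (intro continuous_intros)
  ultimately have "isCont (\<lambda>t. Arg (1 - w * cis (- t))) t" for t
    by (rule isCont_o2[rotated])
  then have "isCont L t" for t
    unfolding L_def by (intro continuous_intros)
  then show "continuous_on UNIV L" by (simp add: continuous_at_imp_continuous_on)
qed

text \<open>Continuity and injectivity force monotonicity; the shift law decides the direction and,
  with intermediate values, gives surjectivity.\<close>

lemma ex_circle_lift:
  assumes "F \<in> disc_isometries"
  shows "\<exists>L. strict_mono L \<and> surj L \<and> (\<forall>t. L (t + 2 * pi) = L t + 2 * pi) \<and> (\<forall>t. cis (L t) = F (cis t))"
proof -
  obtain th w where w: "cmod w < 1" and F: "\<And>z. cmod z \<le> 1 \<Longrightarrow> F z = Moebius_function th w z"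
    using disc_isometryD[OF assms] by blast
  define L where "L t = th + t + 2 * Arg (1 - w * cis (- t))" for t
  have cis_L: "cis (L t) = F (cis t)" and L_shift: "L (t + 2 * pi) = L t + 2 * pi"
    and cont: "continuous_on UNIV L" for t
    using Moebius_circle_lift[OF w] by (simp_all add: L_def F)
  have L_shift_int: "L (t + 2 * pi * of_int m) = L t + 2 * pi * of_int m" for t m
    using shift_multiple[of L "2 * pi" "2 * pi" t m] L_shift by simp
  have Moebius_inj: "z = z'" if "cmod z = 1" "cmod z' = 1" "F z = F z'" for z z'
  proof -
    have "Moebius_function th w z = Moebius_function th w z'" using that F by simp
    moreover have "Moebius_function th w z = exp (\<i> * of_real th) * Moebius_function 0 w z" for z
      by (simp add: Moebius_function_def)
    ultimately have "Moebius_function 0 w z = Moebius_function 0 w z'" by simp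
    then show ?thesis using Moebius_inverse(1)[OF w] that by (metis order_refl)
  qed
  have "inj L"
  proof (rule injI)
    fix t t' assume eq: "L t = L t'"
    have "cis t = cis t'" by (rule Moebius_inj) (use eq in \<open>simp_all add: cis_L[symmetric]\<close>)
    then obtain m :: int where m: "t = t' + 2 * pi * of_int m" using cis_eq_cis_iff by blast
    then show "t = t'" using L_shift_int[of t' m] eq by simp
  qed
  have less: "L x < L y" if "x < y" for x y
  proof -
    define m where "m = \<lceil>(y - x) / (2 * pi)\<rceil>"
    have "(y - x) / (2 * pi) < of_int (m + 1)" unfolding m_def by linarith
    then have y: "y < x + 2 * pi * of_int (m + 1)" by (simp add: field_simps)
    have "0 < (y - x) / (2 * pi)" using that by simp
    then have "m + 1 > 0" unfolding m_def by linarith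
    have "(L x < L y \<and> L y < L (x + 2 * pi * of_int (m + 1))) \<or>
        (L (x + 2 * pi * of_int (m + 1)) < L y \<and> L y < L x)"
      using \<open>inj L\<close> continuous_on_subset[OF cont] y that
      by (intro continuous_inj_imp_mono) (auto intro: inj_on_subset)
    moreover have "L x < L (x + 2 * pi * of_int (m + 1))"
      unfolding L_shift_int using \<open>m + 1 > 0\<close> by (simp only: less_add_same_cancel1) simp
    ultimately show ?thesis by linarith
  qed
  then have "strict_mono L" by (rule strict_monoI)
  moreover have "surj L"
  proof -
    have "\<exists>t. L t = y" for y
    proof -
      define m where "m = \<lfloor>(y - L 0) / (2 * pi)\<rfloor>"
      have "of_int m \<le> (y - L 0) / (2 * pi)" "(y - L 0) / (2 * pi) \<le> of_int (m + 1)"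
        unfolding m_def by linarith+
      then have "L (0 + 2 * pi * of_int m) \<le> y" "y \<le> L (0 + 2 * pi * of_int (m + 1))"
        unfolding L_shift_int by (simp_all add: field_simps)
      moreover have "0 + 2 * pi * of_int m \<le> 0 + 2 * pi * of_int (m + 1)" by simp
      ultimately show ?thesis
        using IVT'[of L "0 + 2 * pi * of_int m" y "0 + 2 * pi * of_int (m + 1)"]
          continuous_on_subset[OF cont] by blast
    qed
    then show ?thesis by (metis surjI)
  qed
  ultimately show ?thesis using L_shift cis_L by blast
qed

lemma cis_add_2pi_int [simp]: "cis (x + 2 * pi * of_int m) = cis x"
  using cis_eq_cis_iff by blast

lemma Arg2pi_cis:
  assumes "0 \<le> x" "x < 2 * pi"
  shows "Arg2pi (cis x) = x"
  using assms by (intro Arg2pi_unique[where r = 1]) (simp_all add: cis_conv_exp)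

lemma cis_Arg2pi: "cmod z = 1 \<Longrightarrow> cis (Arg2pi z) = z"
  using complex_norm_eq_1_exp[of z] by (simp add: cis_conv_exp)

text \<open>Monotonicity does the work of continuity: once the integer is fixed at \<open>0\<close>,
  both functions stay within the same turn on \<open>[0, 2 * pi)\<close>.\<close>

lemma lift_unique:
  fixes G H :: "real \<Rightarrow> real"
  assumes G: "strict_mono G" "\<And>t. G (t + 2 * pi) = G t + 2 * pi"
    and H: "strict_mono H" "\<And>t. H (t + 2 * pi) = H t + 2 * pi"
    and eq: "\<And>t. cis (G t) = cis (H t)"
  shows "\<exists>c::int. \<forall>t. G t = H t + 2 * pi * of_int c"
proof -
  obtain c :: int where c: "G 0 = H 0 + 2 * pi * of_int c"
    using eq[of 0] cis_eq_cis_iff by blast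
  have "G t = H t + 2 * pi * of_int c" for t
  proof -
    define m where "m = \<lfloor>t / (2 * pi)\<rfloor>"
    define r where "r = t - 2 * pi * of_int m"
    have "of_int m \<le> t / (2 * pi)" "t / (2 * pi) < of_int m + 1"
      unfolding m_def by linarith+
    then have r: "0 \<le> r" "r < 0 + 2 * pi" by (simp_all add: r_def field_simps)
    then have "G 0 \<le> G r" "G r < G (0 + 2 * pi)" "H 0 \<le> H r" "H r < H (0 + 2 * pi)"
      using G(1) H(1) by (simp_all only: strict_mono_less strict_mono_less_eq)
    then have bounds: "G 0 \<le> G r" "G r < G 0 + 2 * pi" "G 0 \<le> H r + 2 * pi * of_int c"
      "H r + 2 * pi * of_int c < G 0 + 2 * pi"
      unfolding G(2) H(2) using c by simp_all
    have "G r = H r + 2 * pi * of_int c"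
      by (rule cis_eq_in_window[OF _ bounds]) (simp add: eq)
    moreover have "t = r + 2 * pi * of_int m" by (simp add: r_def)
    ultimately show ?thesis
      using shift_multiple[of G "2 * pi" "2 * pi" r m, OF G(2)]
        shift_multiple[of H "2 * pi" "2 * pi" r m, OF H(2)] by simp
  qed
  then show ?thesis by blast
qed

lemma mem_ccw_arc_half_open_iff:
  assumes "a \<le> b" "b < a + 2 * pi"
  shows "cis t \<in> ccw_arc_half_open (cis a) (cis b) \<longleftrightarrow> (\<exists>m::int. a \<le> t + 2 * pi * of_int m \<and> t + 2 * pi * of_int m < b)"
proof -
  have iff: "cis t \<in> ccw_arc_half_open (cis a) (cis b) \<longleftrightarrow> t + 2 * pi * of_int m < b"
    if "a \<le> t + 2 * pi * of_int m" "t + 2 * pi * of_int m < a + 2 * pi" for m :: int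
  proof -
    have "cis t / cis a = cis (t + 2 * pi * of_int m - a)" "cis b / cis a = cis (b - a)"
      by (simp_all add: cis_divide[symmetric])
    then show ?thesis
      using that assms by (simp add: ccw_arc_half_open_def Arg2pi_cis)
  qed
  show ?thesis
  proof
    assume l: "cis t \<in> ccw_arc_half_open (cis a) (cis b)"
    obtain u where u: "a \<le> u" "u < a + 2 * pi" "cis t = cis u"
      using sphere_eq_cis[of "cis t" a] by auto
    then obtain m :: int where "u = t + 2 * pi * of_int m" by (metis cis_eq_cis_iff)
    then show "\<exists>m::int. a \<le> t + 2 * pi * of_int m \<and> t + 2 * pi * of_int m < b"
      using iff[of m] l u by blast
  next
    assume "\<exists>m::int. a \<le> t + 2 * pi * of_int m \<and> t + 2 * pi * of_int m < b"
    then obtain m :: int where "a \<le> t + 2 * pi * of_int m" "t + 2 * pi * of_int m < b" by blast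
    then show "cis t \<in> ccw_arc_half_open (cis a) (cis b)"
      using iff[of m] assms by simp
  qed
qed

lemma periodic_add_mult:
  assumes "periodic N a"
  shows "a (k + N * m) = a k"
proof (induction m rule: int_induct[where k = 0])
  case (step1 m)
  then show ?case using assms[unfolded periodic_def, rule_format, of "k + N * m"] by (simp add: algebra_simps)
next
  case (step2 m)
  then show ?case using assms[unfolded periodic_def, rule_format, of "k + N * (m - 1)"] by (simp add: algebra_simps)
qed simp

lemma periodic_mod:
  assumes "periodic N a"
  shows "a (k mod N) = a k"
  using periodic_add_mult[OF assms, of "k mod N" "k div N"] by (simp add: mult.commute)

lemma periodic_cong:
  assumes "periodic N a" "N dvd k - l"
  shows "a k = a l"
proof -
  obtain m where "k = l + N * m" using assms(2) by (metis dvdE diff_add_cancel add.commute)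
  then show ?thesis using periodic_add_mult[OF assms(1)] by simp
qed

section \<open>The boundary action of the side pairings\<close>

locale marked_polygon_high_genus = marked_fundamental_polygon +
  assumes g_ge: "g \<ge> 2"
begin

abbreviation N :: int
  where "N \<equiv> num_sides g"

lemma N_eq: "N = 2 * (4 * int g - 2)" and N_ge: "N \<ge> 12"
  using g_ge by (simp_all add: num_sides_def)

text \<open>The side pairing before reduction modulo \<open>N\<close>, so that it is an involution
  of the integers and can index lifts.\<close>

definition sig :: "int \<Rightarrow> int"
  where "sig k = (if odd k then 4 * int g - k else 2 - k)"

lemma side_pairing_eq: "side_pairing g k = sig k mod N"
  by (simp add: side_pairing_def sig_def)

lemma sig_sig [simp]: "sig (sig k) = k"
  by (auto simp: sig_def)

lemma sig_add_mult: "sig (k + N * m) = sig k - N * m"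
  unfolding N_eq sig_def by auto

lemma V_cong: "N dvd k - l \<Longrightarrow> V k = V l" and T_cong: "N dvd k - l \<Longrightarrow> T k = T l"
  using periodic_cong periodic_V periodic_T by blast+

lemma V_norm: "cmod (V k) < 1"
  using V_in_disc[of k] by simp

lemma T_isometry: "T k \<in> disc_isometries"
  using T_in isometries by blast

lemma T_Bij: "T k \<in> Bij (cball 0 1)"
  using subgroup.subset[OF subgroup] T_in by (force simp: BijGroup_def)

lemma T_cball: "cmod z \<le> 1 \<Longrightarrow> cmod (T k z) \<le> 1"
  using disc_isometry_norm[OF T_isometry, of z k] by fastforce

lemma mult_apply:
  assumes "F \<in> Bij (cball 0 1)" "G \<in> Bij (cball 0 1)" "cmod z \<le> 1"
  shows "(F \<otimes>\<^bsub>closed_disc_Bij\<^esub> G) z = F (G z)"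
  using assms by (simp add: BijGroup_def compose_def)

lemma T_sig_T:
  assumes "cmod z \<le> 1"
  shows "T (sig k) (T k z) = z"
proof -
  have "(T (side_pairing g k) \<otimes>\<^bsub>closed_disc_Bij\<^esub> T k) z = z"
    using assms by (simp only: T_inverse) (simp add: BijGroup_def)
  moreover have "T (side_pairing g k) = T (sig k)"
    unfolding side_pairing_eq by (rule periodic_mod[OF periodic_T])
  ultimately show ?thesis using mult_apply[OF T_Bij T_Bij assms] by simp
qed

lemma T_T_sig: "cmod z \<le> 1 \<Longrightarrow> T k (T (sig k) z) = z"
  using T_sig_T[of z "sig k"] by simp

lemma T_V: "T k (V k) = V (sig k + 1)"
proof -
  have "V (side_rho g k) = V (sig k + 1)"
    unfolding side_rho_def side_pairing_eq
    by (rule V_cong) (simp add: mod_eq_dvd_iff[symmetric] mod_add_left_eq)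
  then show ?thesis by (simp add: T_vertex)
qed

lemma T_V_next: "T k (V (k + 1)) = V (sig k)"
  using T_V[of "sig k"] T_T_sig[of "V (sig k)" k] V_norm[of "sig k"] by simp

text \<open>Equal neighbours would be a double point of the simple polygon path; the only double
  point allowed, start and end, would need a polygon with one side.\<close>

lemma V_neq: "V k \<noteq> V (k + 1)"
proof
  assume eq: "V k = V (k + 1)"
  define j where "j = k mod N"
  have j: "0 \<le> j" "j < N" using N_ge by (simp_all add: j_def)
  have "V j = V k" "V (j + 1) = V (k + 1)"
    unfolding j_def by (rule V_cong; simp add: mod_eq_dvd_iff[symmetric] mod_add_left_eq)+
  then have "V j = V (j + 1)" using eq by simp
  moreover have "polygon_path N V (of_int i / of_int N) = V i" for i
    using N_ge by (simp add: polygon_path_def geo_path_def Moebius_function_of_zero)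
  ultimately have "polygon_path N V (of_int j / of_int N) = polygon_path N V (of_int (j + 1) / of_int N)"
    by (simp only:)
  moreover have "of_int j / of_int N \<in> {0..1::real}" "of_int (j + 1) / of_int N \<in> {0..1::real}"
    using j by (simp_all add: divide_le_eq_1)
  ultimately have "of_int j / of_int N = (of_int (j + 1) / of_int N :: real) \<or>
      of_int j / of_int N = (0::real) \<and> of_int (j + 1) / of_int N = (1::real) \<or>
      of_int j / of_int N = (1::real) \<and> of_int (j + 1) / of_int N = (0::real)"
    using simple_polygon unfolding simple_path_def loop_free_def by blast
  then show False using j N_ge by (auto simp: field_simps)
qed

abbreviation P :: "int \<Rightarrow> complex" where "P \<equiv> pt_P V"

abbreviation Q :: "int \<Rightarrow> complex" where "Q \<equiv> pt_Q V"

lemma V_neq': "V (k - 1) \<noteq> V k"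
  using V_neq[of "k - 1"] by simp

lemma P_norm: "cmod (P k) = 1" and Q_norm: "cmod (Q k) = 1"
  unfolding pt_P_def pt_Q_def
  using Moebius_geo_end[OF V_norm V_norm V_neq] Moebius_geo_end[OF V_norm V_norm V_neq'] by blast+

lemma P_periodic: "periodic N P" and Q_periodic: "periodic N Q"
proof -
  have "V (k + N + i) = V (k + i)" for k i by (rule V_cong) simp
  from this[of _ 0] this[of _ 1] this[of _ "-1"]
  show "periodic N P" "periodic N Q" by (simp_all add: periodic_def pt_P_def pt_Q_def)
qed

text \<open>\<open>T k\<close> reverses side \<open>k\<close>: \<open>V k\<close> and
  \<open>V (k + 1)\<close> go to \<open>V (sig k + 1)\<close> and \<open>V (sig k)\<close>, so the
  start of one extension becomes the end of the other.\<close>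

lemma T_P: "T k (P k) = Q (sig k + 1)"
proof -
  have "T k (P k) = geo_start (V (sig k + 1)) (V (sig k))"
    unfolding pt_P_def disc_isometry_geo_end(2)[OF T_isometry V_norm V_norm V_neq] T_V T_V_next ..
  also have "\<dots> = Q (sig k + 1)"
    using geo_start_swap[OF V_norm V_norm V_neq[of "sig k"]] by (simp add: pt_Q_def)
  finally show ?thesis .
qed

lemma T_Q_next: "T k (Q (k + 1)) = P (sig k)"
proof -
  have "T k (Q (k + 1)) = geo_end (V (sig k + 1)) (V (sig k))"
    using disc_isometry_geo_end(1)[OF T_isometry V_norm V_norm V_neq[of k], of k] T_V[of k] T_V_next[of k]
    by (simp add: pt_Q_def)
  also have "\<dots> = P (sig k)"
    using geo_start_swap[OF V_norm V_norm V_neq[of "sig k", symmetric]] by (simp add: pt_P_def)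
  finally show ?thesis .
qed

lemma internal_angle_sig: "internal_angle V k + internal_angle V (sig k + 1) = pi"
proof -
  have "internal_angle V (side_pairing g k + 1) = internal_angle V (sig k + 1)"
  proof -
    have "V (side_pairing g k + i) = V (sig k + i)" for i
      unfolding side_pairing_eq by (rule V_cong) (simp add: mod_eq_dvd_iff[symmetric] mod_add_left_eq)
    from this[of 0] this[of 1] this[of 2] show ?thesis
      by (simp add: internal_angle_def add.assoc)
  qed
  then show ?thesis using angle_sum[of k] by simp
qed

lemma internal_angle_sig': "internal_angle V (k + 1) + internal_angle V (sig k) = pi"
  using internal_angle_sig[of "sig k"] by simp

lemma sgn_internal:
  "sgn (Moebius_function 0 (V k) (V (k - 1))) =
    cis (internal_angle V k) * sgn (Moebius_function 0 (V k) (V (k + 1)))"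
  unfolding internal_angle_def
  by (rule sgn_angle[OF V_norm V_norm V_norm V_neq]) (rule V_neq'[symmetric])

text \<open>
  As the internal angles at \<open>V k\<close> and \<open>V (sig k + 1)\<close> add up to \<open>pi\<close>, \<open>T k\<close> maps the extension
  of side \<open>k - 1\<close> to the extension of side \<open>sig k + 1\<close>.
\<close>

lemma T_Q: "T k (Q k) = Q (sig k + 2)"
proof -
  let ?s = "sig k" and ?M = "\<lambda>x. Moebius_function 0 (V x)"
  obtain u where u: "cmod u = 1"
    "\<And>z. cmod z \<le> 1 \<Longrightarrow> Moebius_function 0 (T k (V k)) (T k z) = u * ?M k z"
    "\<And>z. cmod z \<le> 1 \<Longrightarrow> sgn (Moebius_function 0 (T k (V k)) (T k z)) = u * sgn (?M k z)"
    using disc_isometry_sgn[OF T_isometry V_norm] by blast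
  have "Q k = geo_start (V k) (V (k - 1))"
    using geo_start_swap[OF V_norm V_norm V_neq'] by (simp add: pt_Q_def)
  then have "?M k (Q k) = - sgn (?M k (V (k - 1)))"
    using Moebius_geo_end(3)[OF V_norm V_norm V_neq'[symmetric]] by simp
  then have "?M (?s + 1) (T k (Q k)) = - (cis (internal_angle V k) * (u * sgn (?M k (V (k + 1)))))"
    using u(2)[of "Q k"] Q_norm by (simp add: T_V sgn_internal)
  also have "u * sgn (?M k (V (k + 1))) = sgn (?M (?s + 1) (V ?s))"
    using u(3)[of "V (k + 1)"] V_norm[of "k + 1"] by (simp add: T_V T_V_next)
  also have "\<dots> = cis (internal_angle V (?s + 1)) * sgn (?M (?s + 1) (V (?s + 2)))"
    using sgn_internal[of "?s + 1"] by (simp add: add.assoc)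
  also have "- (cis (internal_angle V k) *
      (cis (internal_angle V (?s + 1)) * sgn (?M (?s + 1) (V (?s + 2))))) =
      - cis (internal_angle V k + internal_angle V (?s + 1)) * sgn (?M (?s + 1) (V (?s + 2)))"
    by (simp add: cis_mult[symmetric])
  also have "\<dots> = sgn (?M (?s + 1) (V (?s + 2)))"
    by (simp add: internal_angle_sig)
  finally have "T k (Q k) = geo_end (V (?s + 1)) (V (?s + 2))"
    using V_norm T_cball[of "Q k" k] Q_norm[of k] by (intro geo_endI) simp_all
  then show ?thesis by (simp add: pt_Q_def add.commute)
qed

text \<open>The angle argument at the other end of side \<open>k\<close>, where the angle
  supplementary to that at \<open>V (k + 1)\<close> sits at \<open>V (sig k)\<close>.\<close>

lemma T_P_next: "T k (P (k + 1)) = P (sig k - 1)"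
proof -
  let ?s = "sig k" and ?M = "\<lambda>x. Moebius_function 0 (V x)"
  obtain u where u: "cmod u = 1"
    "\<And>z. cmod z \<le> 1 \<Longrightarrow> Moebius_function 0 (T k (V (k + 1))) (T k z) = u * ?M (k + 1) z"
    "\<And>z. cmod z \<le> 1 \<Longrightarrow> sgn (Moebius_function 0 (T k (V (k + 1))) (T k z)) = u * sgn (?M (k + 1) z)"
    using disc_isometry_sgn[OF T_isometry V_norm] by blast
  have "?M (k + 1) (P (k + 1)) = - sgn (?M (k + 1) (V (k + 2)))"
    using Moebius_geo_end(3)[OF V_norm V_norm V_neq[of "k + 1"]] by (simp add: pt_P_def add.assoc)
  then have 1: "?M ?s (T k (P (k + 1))) = - (u * sgn (?M (k + 1) (V (k + 2))))"
    using u(2)[of "P (k + 1)"] P_norm by (simp add: T_V_next)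
  have "sgn (?M ?s (V (?s + 1))) = cis (internal_angle V (k + 1)) * (u * sgn (?M (k + 1) (V (k + 2))))"
    using u(3)[of "V k"] V_norm[of k] sgn_internal[of "k + 1"] by (simp add: T_V T_V_next add.assoc)
  then have "sgn (?M ?s (V (?s - 1))) =
      cis (internal_angle V (k + 1) + internal_angle V ?s) * (u * sgn (?M (k + 1) (V (k + 2))))"
    using sgn_internal[of ?s] by (simp add: cis_mult[symmetric])
  then have "?M ?s (T k (P (k + 1))) = sgn (?M ?s (V (?s - 1)))"
    unfolding 1 internal_angle_sig' by simp
  then have "T k (P (k + 1)) = geo_end (V ?s) (V (?s - 1))"
    using V_norm T_cball[of "P (k + 1)" k] P_norm[of "k + 1"] by (intro geo_endI) simp_all
  also have "\<dots> = P (?s - 1)"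
    using geo_start_swap[OF V_norm V_norm V_neq'[symmetric]] by (simp add: pt_P_def)
  finally show ?thesis .
qed

lemma side_rho_cong: "N dvd side_rho g k - (sig k + 1)"
  unfolding side_rho_def side_pairing_eq by (simp add: mod_eq_dvd_iff[symmetric] mod_add_left_eq)

lemma side_rho_mod:
  assumes "N dvd k - l"
  shows "N dvd side_rho g k - (sig l + 1)"
proof -
  obtain m where "k = l + N * m" using assms by (metis dvdE diff_add_cancel add.commute)
  then have "sig k + 1 - (sig l + 1) = N * (- m)" by (simp add: sig_add_mult)
  then have "N dvd side_rho g k - (sig k + 1) + (sig k + 1 - (sig l + 1))"
    using side_rho_cong[of k] by (intro dvd_add) simp_all
  then show ?thesis by (simp only: diff_add_cancel add_diff_eq)
qed

text \<open>The four-term relation started at \<open>k + 1\<close>. Modulo \<open>N\<close> its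
  outermost index is \<open>sig k\<close>, and the next one is \<open>?r2\<close> with
  \<open>sig ?r2\<close> congruent to \<open>sig k - 1\<close>; inverting these two generators
  leaves two equal words of length two.\<close>

lemma T_cocycle:
  assumes z: "cmod z \<le> 1"
  shows "T (sig (k + 1) + 1) (T (k + 1) z) = T (sig k - 1) (T k z)"
proof -
  let ?r1 = "sig (k + 1) + 1"
  let ?r2 = "sig ?r1 + 1"
  have r1: "N dvd side_rho g (k + 1) - ?r1" by (rule side_rho_mod) simp
  have r2: "N dvd (side_rho g ^^ 2) (k + 1) - ?r2"
    using side_rho_mod[OF r1] by (simp add: numeral_2_eq_2)
  have "N dvd (side_rho g ^^ 3) (k + 1) - (sig ?r2 + 1)"
    using side_rho_mod[OF r2] by (simp add: numeral_2_eq_2 numeral_3_eq_3)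
  moreover have "sig ?r2 + 1 - sig k = (if odd k then N * (- 1) else N * 1)"
    by (simp add: sig_def num_sides_def)
  then have sig_r2: "N dvd sig ?r2 + 1 - sig k" by (metis dvd_triv_left)
  ultimately have "N dvd (side_rho g ^^ 3) (k + 1) - (sig ?r2 + 1) + (sig ?r2 + 1 - sig k)"
    by (rule dvd_add)
  then have r3: "N dvd (side_rho g ^^ 3) (k + 1) - sig k" by simp
  have "sig ?r2 + 1 - sig k = sig ?r2 - (sig k - 1)" by simp
  then have r2': "N dvd sig ?r2 - (sig k - 1)" using sig_r2 by (simp only:)
  define b where "b = T ?r1 (T (k + 1) z)"
  have b: "cmod b \<le> 1" unfolding b_def using z by (intro T_cball)
  have comp: "\<And>F G. F \<in> Bij (cball 0 1) \<Longrightarrow> G \<in> Bij (cball 0 1) \<Longrightarrow>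
      F \<otimes>\<^bsub>closed_disc_Bij\<^esub> G \<in> Bij (cball 0 1)"
    by (simp add: BijGroup_def compose_Bij)
  have "T (sig k) (T ?r2 (T ?r1 (T (k + 1) z))) = z"
  proof -
    have "(T (sig k) \<otimes>\<^bsub>closed_disc_Bij\<^esub> (T ?r2 \<otimes>\<^bsub>closed_disc_Bij\<^esub>
        (T ?r1 \<otimes>\<^bsub>closed_disc_Bij\<^esub> T (k + 1)))) z = z"
      using T_relation[of "k + 1"] z
      unfolding T_cong[OF r3] T_cong[OF r2] T_cong[OF r1] by (simp add: BijGroup_def)
    then show ?thesis using z by (simp add: mult_apply comp T_Bij)
  qed
  then have "T (sig k) (T ?r2 b) = z" by (simp add: b_def)
  then have "T k z = T ?r2 b"
    using T_T_sig[of "T ?r2 b" k] T_cball[OF b] by simp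
  then have "T (sig ?r2) (T k z) = b" using T_sig_T[OF b] by simp
  then show ?thesis unfolding b_def T_cong[OF r2'] by simp
qed

end

section \<open>Lifted endpoints and lifted generators\<close>

context marked_polygon_high_genus
begin

text \<open>\<open>ccw_interlaced\<close> compares arguments relative to \<open>P 1\<close> for
  indices from 1 to \<open>N\<close>; a block thus starts at \<open>k = 1\<close>, and
  \<open>(k - 1) div N\<close> counts turns.\<close>

definition p :: "int \<Rightarrow> real"
  where "p k = Arg2pi (P 1) + Arg2pi (P k / P 1) + 2 * pi * of_int ((k - 1) div N)"

definition q :: "int \<Rightarrow> real"
  where "q k = Arg2pi (P 1) + Arg2pi (Q k / P 1) + 2 * pi * of_int ((k - 1) div N)"

lemma cis_p: "cis (p k) = P k" and cis_q: "cis (q k) = Q k"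
proof -
  have nz: "P 1 \<noteq> 0" using P_norm[of 1] by auto
  show "cis (p k) = P k" "cis (q k) = Q k"
    unfolding p_def q_def cis_add_2pi_int cis_mult[symmetric]
    using nz by (simp_all add: cis_Arg2pi P_norm Q_norm norm_divide)
qed

lemma div_add_N: "(k + N - 1) div N = (k - 1) div N + 1"
proof -
  have "k + N - 1 = (k - 1) + N" by simp
  then show ?thesis using N_ge by (simp only: div_add_self2)
qed

lemma p_add_N: "p (k + N) = p k + 2 * pi" and q_add_N: "q (k + N) = q k + 2 * pi"
  using P_periodic Q_periodic unfolding p_def q_def div_add_N
  by (simp_all add: periodic_def algebra_simps)

lemma p_less_q: "p k < q k" and q_less_p: "q k < p (k + 1)"
proof -
  define j where "j = (k - 1) mod N + 1"
  have j: "j \<in> {1..N}"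
    using N_ge by (simp add: j_def add1_zle_eq)
  have k: "k = j + N * ((k - 1) div N)"
    by (simp add: j_def)
  have PQ: "P k = P j" "Q k = Q j" "P (k + 1) = P (j + 1)"
    using periodic_add_mult[OF P_periodic, of j "(k - 1) div N"]
      periodic_add_mult[OF Q_periodic, of j "(k - 1) div N"]
      periodic_add_mult[OF P_periodic, of "j + 1" "(k - 1) div N"] k
    by (simp_all add: algebra_simps)
  note order = endpoint_order[unfolded ccw_interlaced_def]
  show "p k < q k" unfolding p_def q_def PQ using order j by simp
  show "q k < p (k + 1)"
  proof (cases "j = N")
    case True
    \<comment> \<open>At the end of a block the relative argument drops back to 0 while the turn
      count rises by one.\<close>
    have "P (j + 1) = P 1" using periodic_add_mult[OF P_periodic, of 1 1] True by (simp add: add.commute)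
    moreover have "k = N * ((k - 1) div N + 1)" using k True by (simp add: algebra_simps)
    then have "k div N = (k - 1) div N + 1"
      using N_ge by (metis nonzero_mult_div_cancel_left not_numeral_le_zero)
    moreover have "Arg2pi (Q j / P 1) < 2 * pi" using Arg2pi by blast
    moreover have "P 1 \<noteq> 0" using P_norm[of 1] by auto
    ultimately show ?thesis
      unfolding p_def q_def PQ by (simp add: Arg2pi_of_real[of 1, simplified] algebra_simps)
  next
    case False
    then have j': "j \<in> {1..<N}" using j by simp
    define d where "d = (k - 1) div N"
    have "k = j + d * N" using k by (simp add: d_def mult.commute)
    then have "k div N = d + j div N" using N_ge by simp
    then have "k div N = (k - 1) div N"
      using j' by (simp add: d_def div_pos_pos_trivial)
    then show ?thesis unfolding p_def q_def PQ using order j' by simp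
  qed
qed

definition circle_lift :: "(complex \<Rightarrow> complex) \<Rightarrow> real \<Rightarrow> real"
  where "circle_lift F = (SOME L. strict_mono L \<and> surj L \<and>
    (\<forall>t. L (t + 2 * pi) = L t + 2 * pi) \<and> (\<forall>t. cis (L t) = F (cis t)))"

lemma circle_lift:
  "strict_mono (circle_lift (T k))" "surj (circle_lift (T k))"
  "circle_lift (T k) (t + 2 * pi) = circle_lift (T k) t + 2 * pi"
  "cis (circle_lift (T k) t) = T k (cis t)"
  using someI_ex[OF ex_circle_lift[OF T_isometry[of k]], folded circle_lift_def] by blast+

text \<open>A lift is determined up to full turns; the added constant, a multiple of
  \<open>2 * pi\<close> because of \<open>T_P\<close>, selects the one sending \<open>p k\<close> to
  \<open>q (sig k + 1)\<close>.\<close>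

definition tau :: "int \<Rightarrow> real \<Rightarrow> real"
  where "tau k t = circle_lift (T k) t + (q (sig k + 1) - circle_lift (T k) (p k))"

lemma tau_strict_mono: "strict_mono (tau k)"
  using circle_lift(1)[of k] by (simp add: tau_def strict_mono_def)

lemma tau_surj: "surj (tau k)"
proof -
  have "\<exists>t. tau k t = y" for y
    using circle_lift(2)[of k] unfolding tau_def surj_def
    by (metis diff_add_cancel)
  then show ?thesis by (metis surjI)
qed

lemma tau_shift: "tau k (t + 2 * pi) = tau k t + 2 * pi"
  by (simp add: tau_def circle_lift)

lemma tau_p: "tau k (p k) = q (sig k + 1)"
  by (simp add: tau_def)

lemma cis_tau: "cis (tau k t) = T k (cis t)"
proof -
  have "cis (circle_lift (T k) (p k)) = cis (q (sig k + 1))"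
    by (simp add: circle_lift cis_p cis_q T_P)
  then obtain m :: int where "q (sig k + 1) = circle_lift (T k) (p k) + 2 * pi * of_int m"
    using cis_eq_cis_iff by metis
  then have "tau k t = circle_lift (T k) t + 2 * pi * of_int m" by (simp add: tau_def)
  then show ?thesis by (simp add: circle_lift)
qed

lemma tau_add_N: "tau (k + N) (t + 2 * pi) = tau k t - 2 * pi"
proof -
  have "T (k + N) = T k" by (rule T_cong) simp
  moreover have eq: "sig (k + N) + 1 + N = sig k + 1" using sig_add_mult[of k 1] by simp
  have "q (sig (k + N) + 1) = q (sig k + 1) - 2 * pi"
    using q_add_N[of "sig (k + N) + 1"] unfolding eq by simp
  ultimately show ?thesis by (simp add: tau_def p_add_N circle_lift)
qed

lemma p_mono: "i \<le> j \<Longrightarrow> p i \<le> p j" and q_mono: "i \<le> j \<Longrightarrow> q i \<le> q j"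
proof -
  have "p i < p j" "q i < q j" if "i < j"
    using that less_trans[OF p_less_q q_less_p] less_trans[OF q_less_p p_less_q]
    by (auto intro: int_step_strict_mono)
  then show "i \<le> j \<Longrightarrow> p i \<le> p j" "i \<le> j \<Longrightarrow> q i \<le> q j"
    by (cases "i = j"; simp add: less_imp_le)+
qed

text \<open>\<open>tau k\<close> carries the turn after \<open>p k\<close> onto the turn after
  \<open>q (sig k + 1)\<close>, so there the action on the circle determines the value, including
  the right multiple of \<open>N\<close> in its index.\<close>

lemma tau_eqI:
  assumes "p k \<le> t" "t < p k + 2 * pi" and "q (sig k + 1) \<le> y" "y < q (sig k + 1 + N)"
    and "T k (cis t) = cis y"
  shows "tau k t = y"
proof -
  have "tau k (p k) \<le> tau k t" "tau k t < tau k (p k + 2 * pi)"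
    using assms tau_strict_mono[of k] by (simp_all only: strict_mono_less strict_mono_less_eq)
  then show ?thesis
    using assms by (intro cis_eq_in_window[of _ y "q (sig k + 1)"])
      (simp_all add: tau_p tau_shift cis_tau q_add_N)
qed

lemma q_lt: "i < j \<Longrightarrow> q i < q j"
  using q_mono[of "i + 1" j] p_less_q[of "i + 1"] q_less_p[of i] by simp

lemma tau_q: "tau k (q k) = q (sig k + 2)"
proof (rule tau_eqI)
  show "p k \<le> q k" using p_less_q[of k] by simp
  show "q k < p k + 2 * pi"
    using q_less_p[of k] p_mono[of "k + 1" "k + N"] N_ge by (simp add: p_add_N)
  show "q (sig k + 1) \<le> q (sig k + 2)" by (rule q_mono) simp
  show "q (sig k + 2) < q (sig k + 1 + N)" using N_ge by (intro q_lt) simp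
qed (simp add: cis_q T_Q)

lemma tau_p_next: "tau k (p (k + 1)) = p (sig k - 1 + N)"
proof (rule tau_eqI)
  show "p k \<le> p (k + 1)" by (rule p_mono) simp
  show "p (k + 1) < p k + 2 * pi"
    using p_less_q[of "k + 1"] q_less_p[of "k + 1"] p_mono[of "k + 1 + 1" "k + N"] N_ge
    by (simp add: p_add_N)
  show "q (sig k + 1) \<le> p (sig k - 1 + N)"
    using q_less_p[of "sig k + 1"] p_mono[of "sig k + 1 + 1" "sig k - 1 + N"] N_ge by simp
  show "p (sig k - 1 + N) < q (sig k + 1 + N)"
    using p_less_q[of "sig k + 1 + N"] p_mono[of "sig k - 1 + N" "sig k + 1 + N"] by simp
  have "P (sig k - 1 + N) = P (sig k - 1)"
    using periodic_add_mult[OF P_periodic, of "sig k - 1" 1] by simp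
  then show "T k (cis (p (k + 1))) = cis (p (sig k - 1 + N))"
    by (simp add: cis_p T_P_next)
qed

lemma tau_q_next: "tau k (q (k + 1)) = p (sig k + N)"
proof (rule tau_eqI)
  show "p k \<le> q (k + 1)" using p_less_q[of "k + 1"] p_mono[of k "k + 1"] by simp
  show "q (k + 1) < p k + 2 * pi"
    using q_less_p[of "k + 1"] p_mono[of "k + 1 + 1" "k + N"] N_ge by (simp add: p_add_N)
  show "q (sig k + 1) \<le> p (sig k + N)"
    using q_less_p[of "sig k + 1"] p_mono[of "sig k + 1 + 1" "sig k + N"] N_ge by simp
  show "p (sig k + N) < q (sig k + 1 + N)"
    using p_less_q[of "sig k + 1 + N"] p_mono[of "sig k + N" "sig k + 1 + N"] by simp
  have "P (sig k + N) = P (sig k)"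
    using periodic_add_mult[OF P_periodic, of "sig k" 1] by simp
  then show "T k (cis (q (k + 1))) = cis (p (sig k + N))"
    by (simp add: cis_p cis_q T_Q_next)
qed

lemma tau_cocycle:
  "\<exists>c::int. \<forall>t. tau (sig (k + 1) + 1) (tau (k + 1) t) =
    tau (sig k - 1 + N) (tau k t) + 2 * pi * of_int c"
proof (rule lift_unique)
  show "strict_mono (\<lambda>t. tau (sig (k + 1) + 1) (tau (k + 1) t))"
    "strict_mono (\<lambda>t. tau (sig k - 1 + N) (tau k t))"
    using tau_strict_mono by (simp_all add: strict_mono_def)
  have "T (sig k - 1 + N) = T (sig k - 1)" by (rule T_cong) simp
  then show "cis (tau (sig (k + 1) + 1) (tau (k + 1) t)) = cis (tau (sig k - 1 + N) (tau k t))" for t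
    by (simp add: cis_tau T_cocycle)
qed (simp_all add: tau_shift)

abbreviation growth_rate :: real
  where "growth_rate \<equiv> 4 * real g - 3 + sqrt ((4 * real g - 3)\<^sup>2 - 1)"

text \<open>Here \<open>M = 4g - 2\<close>: the difference \<open>sig k - sig (k + 1)\<close> is
  \<open>4g - 1\<close> or \<open>3 - 4g\<close> according to the parity of \<open>k\<close>.
  \<open>growth_rate\<close> is the larger root of the quadratic equation.\<close>

lemma boundary_lift_polygon: "boundary_lift N (4 * int g - 2) sig p q tau growth_rate"
proof
  have g: "real g \<ge> 2" using g_ge by simp
  show "N = 2 * (4 * int g - 2)" by (rule N_eq)
  show "6 \<le> 4 * int g - 2" using g_ge by simp
  have "1\<^sup>2 \<le> (4 * real g - 3)\<^sup>2" using g by (intro power_mono) simp_all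
  then have sq: "(sqrt ((4 * real g - 3)\<^sup>2 - 1))\<^sup>2 = (4 * real g - 3)\<^sup>2 - 1"
    and nn: "0 \<le> sqrt ((4 * real g - 3)\<^sup>2 - 1)" by simp_all
  show "2 < growth_rate" using nn g by linarith
  show "growth_rate * growth_rate = (of_int N - 2) * growth_rate - 1"
    using sq by (simp add: num_sides_def power2_eq_square algebra_simps)
  show "sig (k + N) = sig k - N" for k using sig_add_mult[of k 1] by simp
  show "sig k = sig (k + 1) + (4 * int g - 2) + 1 \<or> sig k = sig (k + 1) + (4 * int g - 2) + 1 - N" for k
    by (auto simp: sig_def num_sides_def)
qed (rule p_less_q q_less_p p_add_N q_add_N tau_strict_mono tau_surj tau_add_N tau_p tau_q tau_p_next
    tau_q_next tau_cocycle)+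

end

section \<open>Lifted cut points and the boundary map\<close>

locale marked_polygon_with_cuts = marked_polygon_high_genus +
  fixes A :: "int \<Rightarrow> complex"
  assumes A_periodic: "periodic N A" and A_mem: "\<And>k. A k \<in> ccw_arc (P k) (Q k)"
begin

text \<open>Measured from \<open>P k\<close>, so that membership of \<open>A k\<close> in its arc
  becomes \<open>alpha k \<le> q k\<close>.\<close>

definition alpha :: "int \<Rightarrow> real"
  where "alpha k = p k + Arg2pi (A k / P k)"

lemma cis_alpha: "cis (alpha k) = A k"
proof -
  have "cmod (A k) = 1" using A_mem[of k] by (simp add: ccw_arc_def)
  moreover have "P k \<noteq> 0" using P_norm[of k] by auto
  ultimately show ?thesis
    by (simp add: alpha_def cis_mult[symmetric] cis_p cis_Arg2pi norm_divide P_norm)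
qed

lemma alpha_bounds: "p k \<le> alpha k" "alpha k \<le> q k"
proof -
  show "p k \<le> alpha k" using Arg2pi[of "A k / P k"] by (simp add: alpha_def)
  have "q k < p k + 2 * pi"
    using q_less_p[of k] p_mono[of "k + 1" "k + N"] N_ge by (simp add: p_add_N)
  moreover have "Q k / P k = cis (q k - p k)"
    by (simp add: cis_p cis_q flip: cis_divide)
  ultimately have "Arg2pi (Q k / P k) = q k - p k"
    using p_less_q[of k] by (simp add: Arg2pi_cis)
  then show "alpha k \<le> q k" using A_mem[of k] by (simp add: alpha_def ccw_arc_def)
qed

lemma alpha_add_N: "alpha (k + N) = alpha k + 2 * pi"
  using A_periodic P_periodic by (simp add: alpha_def p_add_N periodic_def)

lemma alpha_add_mult: "alpha (k + N * m) = alpha k + 2 * pi * of_int m"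
  using shift_multiple[of alpha N "2 * pi" k m, OF alpha_add_N] by simp

lemma alpha_mono: "i < j \<Longrightarrow> alpha i < alpha j"
proof (rule int_step_strict_mono[of alpha])
  show "alpha k < alpha (k + 1)" for k
    using alpha_bounds(2)[of k] q_less_p[of k] alpha_bounds(1)[of "k + 1"] by linarith
qed

lemma alpha_bracket_unique:
  assumes "alpha i \<le> t" "t < alpha (i + 1)" "alpha j \<le> t" "t < alpha (j + 1)"
  shows "i = j"
proof (rule ccontr)
  assume "i \<noteq> j"
  then have "i + 1 \<le> j \<or> j + 1 \<le> i" by linarith
  then have "alpha (i + 1) \<le> alpha j \<or> alpha (j + 1) \<le> alpha i"
    using alpha_mono[of "i + 1" j] alpha_mono[of "j + 1" i] by (auto simp: le_less)
  then show False using assms by linarith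
qed

lemma mem_arc_iff:
  "cis t \<in> ccw_arc_half_open (A k) (A (k + 1)) \<longleftrightarrow>
    (\<exists>m::int. alpha k \<le> t + 2 * pi * of_int m \<and> t + 2 * pi * of_int m < alpha (k + 1))"
proof -
  have "alpha k < alpha (k + 1)" "alpha (k + 1) < alpha (k + N)"
    using N_ge by (simp_all add: alpha_mono)
  then show ?thesis
    using mem_ccw_arc_half_open_iff[of "alpha k" "alpha (k + 1)" t] by (simp add: cis_alpha alpha_add_N)
qed

lemma boundary_map_cis:
  assumes t: "alpha k \<le> t" "t < alpha (k + 1)"
  shows "boundary_map N T A (cis t) = cis (tau k t)"
proof -
  define j where "j = (k - 1) mod N + 1"
  define m where "m = (k - 1) div N"
  have j: "j \<in> {1..N}"
    using N_ge by (simp add: j_def add1_zle_eq)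
  have k: "k = j + N * m" by (simp add: j_def m_def)
  have shift: "alpha (j + i) = alpha (k + i) - 2 * pi * of_int m" for i
    using alpha_add_mult[of "j + i" m] by (simp add: k algebra_simps)
  have mem: "alpha j \<le> t + 2 * pi * of_int (- m)" "t + 2 * pi * of_int (- m) < alpha (j + 1)"
    using t shift[of 0] shift[of 1] by simp_all
  have "(THE j. j \<in> {1..N} \<and> cis t \<in> ccw_arc_half_open (A j) (A (j + 1))) = j"
  proof (rule the_equality)
    show "j \<in> {1..N} \<and> cis t \<in> ccw_arc_half_open (A j) (A (j + 1))"
      unfolding mem_arc_iff using j mem by blast
  next
    fix i assume i: "i \<in> {1..N} \<and> cis t \<in> ccw_arc_half_open (A i) (A (i + 1))"
    then obtain n :: int where n: "alpha i \<le> t + 2 * pi * of_int n" "t + 2 * pi * of_int n < alpha (i + 1)"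
      unfolding mem_arc_iff by blast
    \<comment> \<open>Both brackets are moved to the same point of the line, where the index is
      unique; so \<open>i\<close> and \<open>j\<close> are congruent modulo \<open>N\<close>, hence
      equal in \<open>{1..N}\<close>.\<close>
    have "alpha (i + N * (- n - m)) \<le> t + 2 * pi * of_int (- m)"
      "t + 2 * pi * of_int (- m) < alpha (i + N * (- n - m) + 1)"
      using n alpha_add_mult[of i "- n - m"] alpha_add_mult[of "i + 1" "- n - m"]
      by (simp_all add: algebra_simps)
    then have eq: "i + N * (- n - m) = j"
      using alpha_bracket_unique mem by blast
    have "N dvd j - i" using eq by (metis add_diff_cancel_left' dvd_triv_left)
    then show "i = j"
      using i j zdvd_not_zless[of "j - i" N] zdvd_not_zless[of "i - j" N] dvd_diff_commute[of N j i]
      by (cases i j rule: linorder_cases) auto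
  qed
  moreover have "T j = T k" by (rule T_cong) (simp add: k)
  ultimately show ?thesis by (simp add: boundary_map_def cis_tau)
qed

lemma entropy_boundary_map:
  "topological_entropy (sphere 0 1) circle_dist (boundary_map N T A) = ereal (ln growth_rate)"
proof -
  interpret boundary_lift N "4 * int g - 2" sig p q tau growth_rate
    by (rule boundary_lift_polygon)
  interpret boundary_dynamics N "4 * int g - 2" sig p q tau growth_rate alpha "boundary_map N T A"
    by unfold_locales (simp_all add: alpha_bounds alpha_add_N boundary_map_cis)
  show ?thesis by (rule entropy_eq)
qed

end

theorem theorem1:
  fixes \<Gamma> :: "(complex \<Rightarrow> complex) set" and g :: nat
    and V :: "int \<Rightarrow> complex" and T :: "int \<Rightarrow> complex \<Rightarrow> complex"
    and A :: "int \<Rightarrow> complex"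
  assumes "g \<ge> 2"
    and "marked_fundamental_polygon \<Gamma> g V T"
    and "periodic (num_sides g) A"
    and "\<And>k. A k \<in> ccw_arc (pt_P V k) (pt_Q V k)"
  shows "topological_entropy (sphere 0 1) circle_dist (boundary_map (num_sides g) T A) =
    ereal (ln (4 * real g - 3 + sqrt ((4 * real g - 3)\<^sup>2 - 1)))"
proof -
  interpret marked_fundamental_polygon \<Gamma> g V T by (rule assms(2))
  interpret marked_polygon_with_cuts \<Gamma> g V T A
    by unfold_locales (use assms in auto)
  show ?thesis by (rule entropy_boundary_map)
qed

end
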